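(* Let $v$ be a smooth ($C^\infty$) vector field on a neighborhood of $0$ in $\mathbb{R}^3$, $\xi=(x,y,z)^T$, with vanishing divergence $\nabla\cdot v=0$, of the form $v(\xi)=N\xi+b(\xi)$ where $b(\xi)=O(|\xi|^2)$ and $$N=Dv(0)=\begin{pmatrix}0&1&0\\0&0&1\\0&0&0\end{pmatrix}.$$ Then for every integer $D\ge 2$ there exist a volume-preserving (i.e. with Jacobian determinant identically $1$), near-identity change of coordinates $\eta=\psi(\xi)=\xi+h(\xi)$ with $h(\xi)=O(|\xi|^2)$, and a polynomial $p$ in two variables containing only terms of degree $\ge 2$, such that in the new coordinates $\eta=(\eta_1,\eta_2,\eta_3)$ the vector field becomes $$\dot\eta = N\eta+\hat e_3\,p(\eta_1,\eta_2)+O(|\eta|^{D+1}),\qquad \hat e_3=(0,0,1)^T.$$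
   Context: The transformed vector field is $w(\eta)=D\psi(\psi^{-1}(\eta))\,v(\psi^{-1}(\eta))$. "Up to terms of arbitrary degree" means the equality holds modulo terms of order $|\eta|^{D+1}$, for any prescribed $D$. *)

theory Defs
  imports "HOL-Analysis.Analysis"
begin

fun Ck_on :: "nat \<Rightarrow> ('a::euclidean_space) set \<Rightarrow> ('a \<Rightarrow> 'b::real_normed_vector) \<Rightarrow> bool" where
  "Ck_on 0 S f = continuous_on S f"
| "Ck_on (Suc k) S f = (f differentiable_on S \<and>
      (\<forall>b\<in>Basis. Ck_on k S (\<lambda>x. frechet_derivative f (at x) b)))"

definition smooth_on :: "('a::euclidean_space) set \<Rightarrow> ('a \<Rightarrow> 'b::real_normed_vector) \<Rightarrow> bool" where
  "smooth_on S f \<longleftrightarrow> (\<forall>k. Ck_on k S f)"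

definition jacobian :: "(real^'n \<Rightarrow> real^'m) \<Rightarrow> real^'n \<Rightarrow> real^'n^'m" where
  "jacobian f x = matrix (frechet_derivative f (at x))"

definition divergence :: "(real^'n \<Rightarrow> real^'n) \<Rightarrow> real^'n \<Rightarrow> real" where
  "divergence v x = trace (jacobian v x)"

definition Nmat :: "real^3^3" where
  "Nmat = vector [vector [0,1,0], vector [0,0,1], vector [0,0,0]]"

definition e3 :: "real^3" where
  "e3 = axis 3 1"

definition poly2 :: "nat \<Rightarrow> (nat \<Rightarrow> nat \<Rightarrow> real) \<Rightarrow> real \<Rightarrow> real \<Rightarrow> real" where
  "poly2 K c a b = (\<Sum>i\<le>K. \<Sum>j\<le>K. c i j * a ^ i * b ^ j)"

end

theory Submission
  imports Defs
begin

text \<open>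
  Replace \<open>v\<close> by a Taylor polynomial \<open>P\<close> whose divergence vanishes to order \<open>D\<close>, and normalise \<open>P\<close>
  degree by degree. If \<open>R\<close> is the divergence-free homogeneous part of degree \<open>k\<close> and
  \<open>L = y \<partial>\<^sub>1 + z \<partial>\<^sub>2\<close>, then for any \<open>h\<^sub>1\<close> the choices \<open>h\<^sub>2 = L h\<^sub>1 + R\<^sub>1\<close>, \<open>h\<^sub>3 = L h\<^sub>2 + R\<^sub>2\<close> turn \<open>R\<close> into
  \<open>(0, 0, R\<^sub>3 + L h\<^sub>3)\<close>. This is independent of \<open>z\<close> if \<open>div h = 0\<close>, which is an equation
  \<open>T h\<^sub>1 = g\<close> with \<open>T = 3 \<partial>\<^sub>1 + 3 L \<partial>\<^sub>2 + L\<^sup>2 \<partial>\<^sub>3\<close>. Since \<open>T L\<^sup>n = L\<^sup>n (\<alpha> \<partial>\<^sub>1 + \<beta> L \<partial>\<^sub>2 + L\<^sup>2 \<partial>\<^sub>3)\<close>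
  with \<open>\<alpha> > 0\<close>, \<open>L\<close> is nilpotent in each degree and \<open>\<partial>\<^sub>1\<close> is onto, \<open>T\<close> is onto.

  A divergence-free homogeneous \<open>h\<close> is a sum of shear fields \<open>(n \<bullet> x)\<^sup>k a\<close> with \<open>n \<bullet> a = 0\<close>: it has a
  polynomial vector potential, and polynomials are sums of powers of linear forms. Composing the maps
  \<open>x \<mapsto> x + (n \<bullet> x)\<^sup>k a\<close> gives a polynomial automorphism \<open>id + h + \<dots>\<close> with polynomial inverse and
  Jacobian determinant exactly 1, so no flow or inverse function theorem is needed.
\<close>

section \<open>Polynomial functions on three-space\<close>

definition monom3 :: "nat \<Rightarrow> nat \<Rightarrow> nat \<Rightarrow> real^3 \<Rightarrow> real" where
  "monom3 i j l x = x$1 ^ i * x$2 ^ j * x$3 ^ l"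

text \<open>Polynomials are kept as functions, as finite combinations of monomials whose exponents
  satisfy a predicate. One induction principle then covers homogeneity, order of vanishing, weight
  bounds and independence of \<open>x$3\<close>.\<close>

inductive mspan :: "(nat \<Rightarrow> nat \<Rightarrow> nat \<Rightarrow> bool) \<Rightarrow> (real^3 \<Rightarrow> real) \<Rightarrow> bool"
  for A where
  mspan_zero: "mspan A (\<lambda>_. 0)"
| mspan_step: "A i j l \<Longrightarrow> mspan A f \<Longrightarrow> mspan A (\<lambda>x. c * monom3 i j l x + f x)"

definition deg_eq :: "nat \<Rightarrow> nat \<Rightarrow> nat \<Rightarrow> nat \<Rightarrow> bool" where
  "deg_eq k i j l \<longleftrightarrow> i + j + l = k"

definition deg_ge :: "nat \<Rightarrow> nat \<Rightarrow> nat \<Rightarrow> nat \<Rightarrow> bool" where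
  "deg_ge m i j l \<longleftrightarrow> m \<le> i + j + l"

abbreviation homog :: "nat \<Rightarrow> (real^3 \<Rightarrow> real) \<Rightarrow> bool" where
  "homog k \<equiv> mspan (deg_eq k)"

text \<open>The polynomials that vanish to order \<open>m\<close> at the origin;
  \<open>pord 0\<close> is the class of all polynomials.\<close>

abbreviation pord :: "nat \<Rightarrow> (real^3 \<Rightarrow> real) \<Rightarrow> bool" where
  "pord m \<equiv> mspan (deg_ge m)"

lemma mspan_mono:
  assumes "mspan A f" and "\<And>i j l. A i j l \<Longrightarrow> B i j l"
  shows "mspan B f"
  using assms(1) by induction (auto intro: mspan.intros assms(2))

lemma mspan_add:
  assumes "mspan A f" "mspan A g"
  shows "mspan A (\<lambda>x. f x + g x)"
  using assms(1)
proof induction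
  case mspan_zero
  then show ?case using assms(2) by simp
next
  case (mspan_step i j l f c)
  from mspan.mspan_step[OF mspan_step(1) mspan_step(3), of c] show ?case
    by (simp add: add.assoc)
qed

lemma mspan_scale:
  assumes "mspan A f"
  shows "mspan A (\<lambda>x. c * f x)"
  using assms
proof induction
  case mspan_zero
  then show ?case by (simp add: mspan.mspan_zero)
next
  case (mspan_step i j l f d)
  from mspan.mspan_step[OF mspan_step(1) mspan_step(3), of "c * d"] show ?case
    by (simp add: algebra_simps)
qed

lemma mspan_uminus: "mspan A f \<Longrightarrow> mspan A (\<lambda>x. - f x)"
  using mspan_scale[of A f "-1"] by simp

lemma mspan_diff: "mspan A f \<Longrightarrow> mspan A g \<Longrightarrow> mspan A (\<lambda>x. f x - g x)"
  using mspan_add[of A f "\<lambda>x. - g x"] mspan_uminus by simp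

lemma mspan_sum:
  "(\<And>s. s \<in> S \<Longrightarrow> mspan A (f s)) \<Longrightarrow> mspan A (\<lambda>x. \<Sum>s\<in>S. f s x)"
  by (induction S rule: infinite_finite_induct) (simp_all add: mspan_zero mspan_add)

lemma mspan_monom: "A i j l \<Longrightarrow> mspan A (\<lambda>x. c * monom3 i j l x)"
  using mspan_step[OF _ mspan_zero, of A i j l c] by simp

lemma mspan_mult:
  assumes "mspan A f" "mspan B g"
    and C: "\<And>i j l i' j' l'. A i j l \<Longrightarrow> B i' j' l' \<Longrightarrow> C (i + i') (j + j') (l + l')"
  shows "mspan C (\<lambda>x. f x * g x)"
  using assms(1)
proof induction
  case mspan_zero
  then show ?case by (simp add: mspan.mspan_zero)
next
  case (mspan_step i j l f c)
  have "mspan C (\<lambda>x. c * monom3 i j l x * g x)"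
    using assms(2)
  proof induction
    case mspan_zero
    then show ?case by (simp add: mspan.mspan_zero)
  next
    case (mspan_step i' j' l' g d)
    from mspan.mspan_step[OF C[OF \<open>A i j l\<close> mspan_step(1)] mspan_step(3), of "c * d"]
    show ?case by (simp add: monom3_def algebra_simps power_add)
  qed
  from mspan_add[OF this mspan_step(3)] show ?case by (simp add: algebra_simps)
qed

lemma pord_mult: "pord m f \<Longrightarrow> pord n g \<Longrightarrow> pord (m + n) (\<lambda>x. f x * g x)"
  by (erule (1) mspan_mult) (simp add: deg_ge_def deg_eq_def)

lemma homog_mult: "homog m f \<Longrightarrow> homog n g \<Longrightarrow> homog (m + n) (\<lambda>x. f x * g x)"
  by (erule (1) mspan_mult) (simp add: deg_ge_def deg_eq_def)

lemma pord_mono: "pord m f \<Longrightarrow> n \<le> m \<Longrightarrow> pord n f"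
  by (erule mspan_mono) (simp add: deg_ge_def deg_eq_def)

lemma homog_pord: "homog k f \<Longrightarrow> m \<le> k \<Longrightarrow> pord m f"
  by (erule mspan_mono) (simp add: deg_ge_def deg_eq_def)

lemma pord_mult_mono: "pord m f \<Longrightarrow> pord n g \<Longrightarrow> k \<le> m + n \<Longrightarrow> pord k (\<lambda>x. f x * g x)"
  using pord_mono pord_mult by blast

lemma pord_const: "pord 0 (\<lambda>_. c)"
  using mspan_monom[of "deg_ge 0" 0 0 0 c] by (simp add: monom3_def deg_ge_def deg_eq_def)

lemma homog_coord: "homog 1 (\<lambda>x. x$i)"
  using mspan_monom[of "deg_eq 1" 1 0 0 1]
    mspan_monom[of "deg_eq 1" 0 1 0 1]
    mspan_monom[of "deg_eq 1" 0 0 1 1]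
    exhaust_3[of i]
  by (auto simp: monom3_def deg_ge_def deg_eq_def)

lemma pord_coord: "pord 1 (\<lambda>x. x$i)"
  by (rule homog_pord[OF homog_coord]) simp

lemma pord_power: "pord m f \<Longrightarrow> pord (m * k) (\<lambda>x. f x ^ k)"
proof (induction k)
  case 0
  then show ?case using pord_const[of 1] by simp
next
  case (Suc k)
  then show ?case using pord_mult[of m f "m * k" "\<lambda>x. f x ^ k"] by (simp add: ac_simps)
qed

lemma mspan_pord0: "mspan A f \<Longrightarrow> pord 0 f"
  by (erule mspan_mono) (simp add: deg_ge_def deg_eq_def)

lemma pord_compose:
  assumes "pord m f" and "\<And>i. pord 1 (\<lambda>x. \<psi> x $ i)"
  shows "pord m (\<lambda>x. f (\<psi> x))"
  using assms(1)
proof induction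
  case mspan_zero
  then show ?case by (simp add: mspan.mspan_zero)
next
  case (mspan_step i j l f c)
  have "pord (1 * i + 1 * j + 1 * l) (\<lambda>x. \<psi> x $ 1 ^ i * \<psi> x $ 2 ^ j * \<psi> x $ 3 ^ l)"
    by (intro pord_mult pord_power assms)
  then have "pord m (\<lambda>x. c * monom3 i j l (\<psi> x))"
    unfolding monom3_def using mspan_step(1)
    by (intro mspan_scale, elim pord_mono) (simp add: deg_ge_def)
  from mspan_add[OF this mspan_step(3)] show ?case .
qed

text \<open>A shear of exponent 0 moves the origin, so composition with it preserves polynomiality
  but no order of vanishing.\<close>

lemma pord_compose0:
  assumes "pord 0 f" and "\<And>i. pord 0 (\<lambda>x. \<psi> x $ i)"
  shows "pord 0 (\<lambda>x. f (\<psi> x))"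
  using assms(1)
proof induction
  case mspan_zero
  then show ?case by (simp add: mspan.mspan_zero)
next
  case (mspan_step i j l f c)
  have "pord (0 * i + 0 * j + 0 * l) (\<lambda>x. \<psi> x $ 1 ^ i * \<psi> x $ 2 ^ j * \<psi> x $ 3 ^ l)"
    by (intro pord_mult pord_power assms)
  then have "pord 0 (\<lambda>x. c * monom3 i j l (\<psi> x))"
    unfolding monom3_def by (intro mspan_scale) simp
  from mspan_add[OF this mspan_step(3)] show ?case .
qed

text \<open>The order of vanishing goes up by \<open>k - 1\<close>, as in \<open>f (x + g) - f x \<approx> f' x g\<close>.\<close>

lemma pord_compose_diff:
  assumes "pord m f" and "\<And>i. pord k (\<lambda>x. \<psi> x $ i - x $ i)"
    and "1 \<le> k" "n + 1 \<le> m + k"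
  shows "pord n (\<lambda>x. f (\<psi> x) - f x)"
proof -
  \<comment> \<open>\<open>good\<close> is strengthened to be closed under products, by f(\<psi>)
    g(\<psi>) - f g = (f(\<psi>) - f) g(\<psi>) + f (g(\<psi>) - g). Writing
    \<open>n + 1 \<le> m + k\<close> instead of subtracting keeps the constants, with
    \<open>m = 0\<close>, within the same pattern.\<close>
  define good where "good m f \<longleftrightarrow>
    pord m f \<and> (\<forall>n. n + 1 \<le> m + k \<longrightarrow> pord n (\<lambda>x. f (\<psi> x) - f x))" for m and f :: "real^3 \<Rightarrow> real"
  have \<psi>: "pord 1 (\<lambda>x. \<psi> x $ i)" for i
    using mspan_add[OF pord_mono[OF assms(2)[of i] assms(3)] pord_coord[of i]] by simp
  have coord: "good 1 (\<lambda>x. x $ i)" for i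
    using pord_coord[of i] pord_mono[OF assms(2)[of i]] by (simp add: good_def)
  have mult: "good (m1 + m2) (\<lambda>x. f x * g x)" if f: "good m1 f" and g: "good m2 g" for m1 m2 f g
    unfolding good_def
  proof (intro conjI allI impI)
    show "pord (m1 + m2) (\<lambda>x. f x * g x)"
      using f g by (intro pord_mult) (auto simp: good_def)
    fix n assume n: "n + 1 \<le> m1 + m2 + k"
    have g': "pord m2 (\<lambda>x. g (\<psi> x))"
      using g by (intro pord_compose[OF _ \<psi>]) (simp add: good_def)
    have "pord (m1 + k - 1) (\<lambda>x. f (\<psi> x) - f x)" "pord (m2 + k - 1) (\<lambda>x. g (\<psi> x) - g x)"
      using f g assms(3) by (auto simp: good_def)
    then have "pord ((m1 + k - 1) + m2) (\<lambda>x. (f (\<psi> x) - f x) * g (\<psi> x))"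
      and "pord (m1 + (m2 + k - 1)) (\<lambda>x. f x * (g (\<psi> x) - g x))"
      using g' f by (auto simp only: good_def intro!: pord_mult)
    then have "pord n (\<lambda>x. (f (\<psi> x) - f x) * g (\<psi> x))"
      and "pord n (\<lambda>x. f x * (g (\<psi> x) - g x))"
      using n assms(3) by (auto elim!: pord_mono)
    from mspan_add[OF this] show "pord n (\<lambda>x. f (\<psi> x) * g (\<psi> x) - f x * g x)"
      by (simp add: algebra_simps)
  qed
  have const: "good 0 (\<lambda>x. c)" for c
    by (auto simp: good_def pord_const[of c] mspan_zero)
  have power: "good e (\<lambda>x. x $ i ^ e)" for i e
    by (induction e) (use const mult[OF coord] in simp_all)
  have monom: "good (i + j + l) (\<lambda>x. c * monom3 i j l x)" for i j l c
    using mult[OF const mult[OF mult[OF power[of i 1] power[of j 2]] power[of l 3]]]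
    by (simp add: monom3_def deg_ge_def deg_eq_def)
  from assms(1) show ?thesis
  proof induction
    case mspan_zero
    then show ?case by (simp add: mspan.mspan_zero)
  next
    case (mspan_step i j l f c)
    have "pord n (\<lambda>x. c * monom3 i j l (\<psi> x) - c * monom3 i j l x)"
      using monom[of i j l c] mspan_step(1) assms(4) by (auto simp: good_def deg_ge_def)
    from mspan_add[OF this mspan_step(3)] show ?case by (simp add: algebra_simps)
  qed
qed

lemma homog_scaleR: "homog k f \<Longrightarrow> f (t *\<^sub>R x) = t ^ k * f x"
  by (induction rule: mspan.induct)
    (auto simp: deg_eq_def monom3_def algebra_simps power_add power_mult_distrib)

lemma pord_decomp:
  assumes "pord m f"
  obtains h g where "homog m h" "pord (Suc m) g" "f = (\<lambda>x. h x + g x)"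
proof -
  have "\<exists>h g. homog m h \<and> pord (Suc m) g \<and> f = (\<lambda>x. h x + g x)"
    using assms
  proof induction
    case mspan_zero
    then show ?case by (intro exI[of _ "\<lambda>_. 0"]) (simp add: mspan.mspan_zero)
  next
    case (mspan_step i j l f c)
    then obtain h g where hg: "homog m h" "pord (Suc m) g" "f = (\<lambda>x. h x + g x)"
      by blast
    show ?case
    proof (cases "i + j + l = m")
      case True
      then have "homog m (\<lambda>x. c * monom3 i j l x + h x)"
        using hg by (auto intro: mspan.mspan_step simp: deg_eq_def)
      then show ?thesis
        using hg by (intro exI[of _ "\<lambda>x. c * monom3 i j l x + h x"] exI[of _ g]) (simp add: add.assoc)
    next
      case False
      then have "pord (Suc m) (\<lambda>x. c * monom3 i j l x + g x)"
        using hg mspan_step(1) by (auto intro!: mspan.mspan_step simp: deg_ge_def)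
      then show ?thesis
        using hg(1,3) by (intro exI[of _ h] exI[of _ "\<lambda>x. c * monom3 i j l x + g x"]) (simp add: algebra_simps)
    qed
  qed
  then show thesis using that by blast
qed

lemma pord_bound:
  assumes "pord m f"
  shows "\<exists>C\<ge>0. \<forall>x. norm x \<le> 1 \<longrightarrow> \<bar>f x\<bar> \<le> C * norm x ^ m"
  using assms
proof induction
  case mspan_zero
  then show ?case by (intro exI[of _ 0]) simp
next
  case (mspan_step i j l f c)
  then obtain C where C: "C \<ge> 0" "\<And>x. norm x \<le> 1 \<Longrightarrow> \<bar>f x\<bar> \<le> C * norm x ^ m" by blast
  have "\<bar>c * monom3 i j l x + f x\<bar> \<le> (\<bar>c\<bar> + C) * norm x ^ m" if x: "norm x \<le> 1" for x
  proof -
    have "\<bar>monom3 i j l x\<bar> \<le> norm x ^ i * norm x ^ j * norm x ^ l"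
      unfolding monom3_def abs_mult power_abs
      by (intro mult_mono power_mono component_le_norm_cart) auto
    also have "\<dots> = norm x ^ (i + j + l)" by (simp add: power_add)
    also have "\<dots> \<le> norm x ^ m"
      using x mspan_step(1) by (intro power_decreasing) (auto simp: deg_ge_def)
    finally have "\<bar>c * monom3 i j l x\<bar> \<le> \<bar>c\<bar> * norm x ^ m"
      by (simp add: abs_mult mult_left_mono)
    with C(2)[OF x] show ?thesis by (simp add: algebra_simps)
  qed
  then show ?case using C(1) by (intro exI[of _ "\<bar>c\<bar> + C"]) simp
qed

text \<open>Along a ray, \<open>f (t *\<^sub>R x)\<close> is t^k f(x) but bounded by a multiple of
  t^(k+1). Dividing by t^k and letting t tend to 0 forces f(x) = 0.\<close>

lemma homog_bounded_eq_0:
  assumes "homog k f" and "r > 0" and "\<And>x. norm x < r \<Longrightarrow> \<bar>f x\<bar> \<le> C * norm x ^ Suc k"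
  shows "f = (\<lambda>_. 0)"
proof
  fix x :: "real^3"
  have "((\<lambda>t. C * t * norm x ^ Suc k) \<longlongrightarrow> C * 0 * norm x ^ Suc k) (at_right 0)"
    by (intro tendsto_intros)
  moreover have "\<forall>\<^sub>F t in at_right 0. \<bar>f x\<bar> \<le> C * t * norm x ^ Suc k"
  proof -
    have "((\<lambda>t. t * norm x) \<longlongrightarrow> 0 * norm x) (at_right 0)" by (intro tendsto_intros)
    then have "\<forall>\<^sub>F t in at_right 0. t * norm x < r"
      using assms(2) by (auto dest: order_tendstoD)
    moreover have "\<forall>\<^sub>F t::real in at_right 0. 0 < t" by (simp add: eventually_at_right_less)
    ultimately show ?thesis
    proof eventually_elim
      case (elim t)
      have "t ^ k * \<bar>f x\<bar> = \<bar>f (t *\<^sub>R x)\<bar>"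
        using elim by (simp add: homog_scaleR[OF assms(1)] abs_mult)
      also have "\<dots> \<le> C * norm (t *\<^sub>R x) ^ Suc k"
        using elim by (intro assms(3)) simp
      also have "\<dots> = t ^ k * (C * t * norm x ^ Suc k)"
        using elim by (simp add: power_mult_distrib)
      finally show ?case using elim by simp
    qed
  qed
  ultimately have "\<bar>f x\<bar> \<le> C * 0 * norm x ^ Suc k"
    by (intro tendsto_lowerbound) auto
  then show "f x = 0" by simp
qed

lemma homog_pord_eq_0:
  assumes "homog k f" and "pord (Suc k) f"
  shows "f = (\<lambda>_. 0)"
proof -
  from pord_bound[OF assms(2)] obtain C where
    "\<And>x. norm x \<le> 1 \<Longrightarrow> \<bar>f x\<bar> \<le> C * norm x ^ Suc k" by blast
  then show ?thesis by (intro homog_bounded_eq_0[OF assms(1), of 1 C]) auto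
qed

text \<open>Turns an analytic estimate into an algebraic order of vanishing. The order is raised one
  step at a time: the lowest homogeneous part is bounded by a higher power of the norm, hence
  zero.\<close>

lemma bounded_pord:
  assumes "pord 0 f" and "r > 0" and bd: "\<And>x. norm x < r \<Longrightarrow> \<bar>f x\<bar> \<le> C * norm x ^ m"
  shows "pord m f"
proof -
  have "pord n f" if "n \<le> m" for n
    using that
  proof (induction n)
    case 0
    then show ?case using assms(1) by simp
  next
    case (Suc n)
    then have "pord n f" by simp
    then obtain h g where hg: "homog n h" "pord (Suc n) g" "f = (\<lambda>x. h x + g x)"
      by (rule pord_decomp)
    from pord_bound[OF hg(2)] obtain C' where
      C': "\<And>x. norm x \<le> 1 \<Longrightarrow> \<bar>g x\<bar> \<le> C' * norm x ^ Suc n" by blast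
    have "\<bar>h x\<bar> \<le> (\<bar>C\<bar> + C') * norm x ^ Suc n" if x: "norm x < min r 1" for x
    proof -
      have "\<bar>f x\<bar> \<le> \<bar>C\<bar> * norm x ^ m"
        using bd[of x] x mult_right_mono[OF abs_ge_self[of C], of "norm x ^ m"] by force
      also have "\<dots> \<le> \<bar>C\<bar> * norm x ^ Suc n"
        using x Suc(2) by (intro mult_left_mono power_decreasing) auto
      finally have "\<bar>f x\<bar> \<le> \<bar>C\<bar> * norm x ^ Suc n" .
      moreover have "\<bar>g x\<bar> \<le> C' * norm x ^ Suc n" using C'[of x] x by simp
      moreover have "\<bar>h x\<bar> \<le> \<bar>f x\<bar> + \<bar>g x\<bar>" using hg(3) by simp
      ultimately show ?thesis by (simp add: algebra_simps)
    qed
    from homog_bounded_eq_0[OF hg(1) _ this] assms(2) have "h = (\<lambda>_. 0)"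
      by (metis min_less_iff_conj zero_less_one)
    then show ?case using hg by simp
  qed
  then show ?thesis by simp
qed

section \<open>Partial derivatives of polynomial functions\<close>

definition pd :: "3 \<Rightarrow> (real^3 \<Rightarrow> real) \<Rightarrow> real^3 \<Rightarrow> real" where
  "pd i f x = frechet_derivative f (at x) (axis i 1)"

lemma pd_eqI: "(f has_derivative f') (at x) \<Longrightarrow> pd i f x = f' (axis i 1)"
  by (simp add: pd_def frechet_derivative_at[symmetric])

lemma monom3_has_derivative:
  "(monom3 i j l has_derivative (\<lambda>h. real i * monom3 (i - 1) j l x * h$1
     + real j * monom3 i (j - 1) l x * h$2 + real l * monom3 i j (l - 1) x * h$3)) (at x)"
  unfolding monom3_def
  by (auto intro!: derivative_eq_intros bounded_linear.has_derivative[OF bounded_linear_vec_nth]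
      simp: algebra_simps)

lemma axis3_nth [simp]:
  "axis (1::3) (1::real) $ 1 = 1" "axis (1::3) (1::real) $ 2 = 0" "axis (1::3) (1::real) $ 3 = 0"
  "axis (2::3) (1::real) $ 1 = 0" "axis (2::3) (1::real) $ 2 = 1" "axis (2::3) (1::real) $ 3 = 0"
  "axis (3::3) (1::real) $ 1 = 0" "axis (3::3) (1::real) $ 2 = 0" "axis (3::3) (1::real) $ 3 = 1"
  by (simp_all add: axis_def)

lemma pd_monom3:
  "pd 1 (monom3 i j l) = (\<lambda>x. real i * monom3 (i - 1) j l x)"
  "pd 2 (monom3 i j l) = (\<lambda>x. real j * monom3 i (j - 1) l x)"
  "pd 3 (monom3 i j l) = (\<lambda>x. real l * monom3 i j (l - 1) x)"
  by (simp_all add: fun_eq_iff pd_eqI[OF monom3_has_derivative])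

lemma mspan_differentiable:
  assumes "mspan A f"
  shows "f differentiable (at x)"
  using assms
proof induction
  case (mspan_step i j l f c)
  have "monom3 i j l differentiable (at x)"
    using monom3_has_derivative differentiable_def by blast
  with mspan_step show ?case by (intro derivative_intros)
qed simp

lemma mspan_frechet:
  "mspan A f \<Longrightarrow> (f has_derivative frechet_derivative f (at x)) (at x)"
  using mspan_differentiable frechet_derivative_works by blast

lemma pd_const: "pd i (\<lambda>x. c) = (\<lambda>x. 0)"
  by (rule ext) (rule pd_eqI[OF has_derivative_const])

lemma pd_coord: "pd i (\<lambda>x. x$j) = (\<lambda>x. if i = j then 1 else 0)"
proof
  fix x :: "real^3"
  have "((\<lambda>x. x$j) has_derivative (\<lambda>h::real^3. h$j)) (at x)"
    by (rule bounded_linear_imp_has_derivative[OF bounded_linear_vec_nth])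
  from pd_eqI[OF this] show "pd i (\<lambda>x. x$j) x = (if i = j then 1 else 0)"
    by (simp add: axis_def)
qed

lemma pd_add:
  assumes "mspan A f" "mspan B g"
  shows "pd i (\<lambda>x. f x + g x) = (\<lambda>x. pd i f x + pd i g x)"
proof
  fix x
  from has_derivative_add[OF assms[THEN mspan_frechet]]
  show "pd i (\<lambda>x. f x + g x) x = pd i f x + pd i g x"
    by (subst pd_eqI, assumption) (simp add: pd_def)
qed

lemma pd_diff:
  assumes "mspan A f" "mspan B g"
  shows "pd i (\<lambda>x. f x - g x) = (\<lambda>x. pd i f x - pd i g x)"
proof
  fix x
  from has_derivative_diff[OF assms[THEN mspan_frechet]]
  show "pd i (\<lambda>x. f x - g x) x = pd i f x - pd i g x"
    by (subst pd_eqI, assumption) (simp add: pd_def)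
qed

lemma pd_mult:
  assumes "mspan A f" "mspan B g"
  shows "pd i (\<lambda>x. f x * g x) = (\<lambda>x. f x * pd i g x + pd i f x * g x)"
proof
  fix x
  from has_derivative_mult[OF assms[THEN mspan_frechet]]
  show "pd i (\<lambda>x. f x * g x) x = f x * pd i g x + pd i f x * g x"
    by (subst pd_eqI, assumption) (simp add: pd_def)
qed

lemma pd_scale:
  assumes "mspan A f"
  shows "pd i (\<lambda>x. c * f x) = (\<lambda>x. c * pd i f x)"
  using pd_mult[OF pord_const[of c] assms, of i] by (simp add: pd_const)

lemma mspan_monom3: "pord 0 (monom3 i j l)"
  using mspan_monom[of "deg_ge 0" i j l 1] by (simp add: deg_ge_def)

lemma pd_step:
  assumes "mspan A f"
  shows "pd k (\<lambda>x. c * monom3 i j l x + f x) = (\<lambda>x. c * pd k (monom3 i j l) x + pd k f x)"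
  using pd_add[OF mspan_scale[OF mspan_monom3] assms] pd_scale[OF mspan_monom3] by simp

lemma mspan_has_derivative:
  assumes "mspan A f"
  shows "(f has_derivative (\<lambda>h. \<Sum>i\<in>UNIV. pd i f x * h$i)) (at x)"
proof -
  have lin: "linear (frechet_derivative f (at x))"
    by (rule linear_frechet_derivative[OF mspan_differentiable[OF assms]])
  have "frechet_derivative f (at x) h = (\<Sum>i\<in>UNIV. pd i f x * h$i)" for h
  proof -
    have h: "h = h$1 *\<^sub>R axis 1 1 + h$2 *\<^sub>R axis 2 1 + h$3 *\<^sub>R axis 3 1"
      by (simp add: vec_eq_iff forall_3)
    show ?thesis
      by (subst h) (simp add: linear_add[OF lin] linear_scale[OF lin] pd_def sum_3)
  qed
  then have "frechet_derivative f (at x) = (\<lambda>h. \<Sum>i\<in>UNIV. pd i f x * h$i)" by blast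
  with mspan_frechet[OF assms, of x] show ?thesis by simp
qed

text \<open>Differentiation shifts one exponent. With arbitrary predicates \<open>A\<close> and
  \<open>B\<close> the same statement serves degree, order, the weight in
  \<open>lieN_nilpotent\<close> and independence of \<open>x$3\<close>.\<close>

lemma mspan_pd1:
  assumes "mspan A f" and B: "\<And>i j l. A (Suc i) j l \<Longrightarrow> B i j l"
  shows "mspan B (pd 1 f)"
  using assms(1)
proof induction
  case mspan_zero
  then show ?case by (simp add: pd_const mspan.mspan_zero)
next
  case (mspan_step i j l f c)
  then show ?case
    using B mspan.mspan_step[of B "i - 1" j l "pd 1 f" "c * real i"]
    by (cases i) (auto simp: pd_step pd_monom3 mult.assoc)
qed

lemma mspan_pd2:
  assumes "mspan A f" and B: "\<And>i j l. A i (Suc j) l \<Longrightarrow> B i j l"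
  shows "mspan B (pd 2 f)"
  using assms(1)
proof induction
  case mspan_zero
  then show ?case by (simp add: pd_const mspan.mspan_zero)
next
  case (mspan_step i j l f c)
  then show ?case
    using B mspan.mspan_step[of B i "j - 1" l "pd 2 f" "c * real j"]
    by (cases j) (auto simp: pd_step pd_monom3 mult.assoc)
qed

lemma mspan_pd3:
  assumes "mspan A f" and B: "\<And>i j l. A i j (Suc l) \<Longrightarrow> B i j l"
  shows "mspan B (pd 3 f)"
  using assms(1)
proof induction
  case mspan_zero
  then show ?case by (simp add: pd_const mspan.mspan_zero)
next
  case (mspan_step i j l f c)
  then show ?case
    using B mspan.mspan_step[of B i j "l - 1" "pd 3 f" "c * real l"]
    by (cases l) (auto simp: pd_step pd_monom3 mult.assoc)
qed

lemma pord_pd: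
  assumes "pord m f"
  shows "pord (m - 1) (pd i f)"
proof -
  have "pord (m - 1) (pd 1 f)" "pord (m - 1) (pd 2 f)" "pord (m - 1) (pd 3 f)"
    using assms by (auto simp: deg_ge_def deg_eq_def elim: mspan_pd1 mspan_pd2 mspan_pd3)
  then show ?thesis using exhaust_3[of i] by auto
qed

lemma homog_pd:
  assumes "homog (Suc k) f"
  shows "homog k (pd i f)"
proof -
  have "homog k (pd 1 f)" "homog k (pd 2 f)" "homog k (pd 3 f)"
    using assms by (auto simp: deg_ge_def deg_eq_def elim: mspan_pd1 mspan_pd2 mspan_pd3)
  then show ?thesis using exhaust_3[of i] by auto
qed

lemma pord0_pd: "pord 0 f \<Longrightarrow> pord 0 (pd i f)"
  using pord_pd[of 0 f i] by simp

lemma pd_commute: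
  assumes "pord 0 f"
  shows "pd i (pd j f) = pd j (pd i f)"
  using assms
proof induction
  case mspan_zero
  then show ?case by (simp add: pd_const)
next
  case (mspan_step i' j' l' f c)
  have "pd i (pd j (monom3 i' j' l')) = pd j (pd i (monom3 i' j' l'))"
    using exhaust_3[of i] exhaust_3[of j]
    by (auto simp: pd_monom3 pd_scale[OF mspan_monom3])
  moreover have "pord 0 (pd i f)" "pord 0 (pd j f)"
    "pord 0 (pd i (monom3 i' j' l'))" "pord 0 (pd j (monom3 i' j' l'))"
    using mspan_step(2) by (auto intro: pord0_pd mspan_monom3)
  ultimately show ?case
    using mspan_step
    by (simp add: pd_step[OF mspan_step(2)] pd_add[OF mspan_scale] pd_scale)
qed

lemma pd1_surj:
  assumes "homog k g"
  shows "\<exists>G. homog (Suc k) G \<and> pd 1 G = g"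
  using assms
proof induction
  case mspan_zero
  then show ?case by (intro exI[of _ "\<lambda>_. 0"]) (simp add: mspan.mspan_zero pd_const)
next
  case (mspan_step i j l g c)
  then obtain G where G: "homog (Suc k) G" "pd 1 G = g" by blast
  define d where "d = c / real (Suc i)"
  have "homog (Suc k) (\<lambda>x. d * monom3 (Suc i) j l x + G x)"
    using mspan_step(1) G(1) by (intro mspan.mspan_step) (auto simp: deg_eq_def)
  moreover have "pd 1 (\<lambda>x. d * monom3 (Suc i) j l x + G x) = (\<lambda>x. c * monom3 i j l x + g x)"
    unfolding pd_step[OF G(1)] pd_monom3 G(2)
    by (simp add: d_def del: of_nat_Suc)
  ultimately show ?case by blast
qed

lemma euler_homog:
  assumes "homog k f"
  shows "x$1 * pd 1 f x + x$2 * pd 2 f x + x$3 * pd 3 f x = real k * f x"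
  using assms
proof induction
  case mspan_zero
  then show ?case by (simp add: pd_const)
next
  case (mspan_step i j l f c)
  have m: "x$1 * (real i * monom3 (i - 1) j l x) + x$2 * (real j * monom3 i (j - 1) l x)
    + x$3 * (real l * monom3 i j (l - 1) x) = real k * monom3 i j l x"
    unfolding mspan_step(1)[unfolded deg_eq_def, symmetric]
    by (cases i; cases j; cases l) (simp_all add: monom3_def algebra_simps)
  have "x$1 * pd 1 (\<lambda>x. c * monom3 i j l x + f x) x + x$2 * pd 2 (\<lambda>x. c * monom3 i j l x + f x) x
    + x$3 * pd 3 (\<lambda>x. c * monom3 i j l x + f x) x
    = c * (x$1 * (real i * monom3 (i - 1) j l x) + x$2 * (real j * monom3 i (j - 1) l x)
    + x$3 * (real l * monom3 i j (l - 1) x)) + (x$1 * pd 1 f x + x$2 * pd 2 f x + x$3 * pd 3 f x)"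
    unfolding pd_step[OF mspan_step(2)] pd_monom3 by (simp add: algebra_simps)
  also have "\<dots> = real k * (c * monom3 i j l x + f x)"
    unfolding m mspan_step(3) by (simp add: algebra_simps)
  finally show ?case .
qed

section \<open>The homological equation\<close>

text \<open>The Lie derivative along the linear field \<open>Nmat *v x\<close>, whose components are
  \<open>x$2\<close>, \<open>x$3\<close> and 0.\<close>

definition lieN :: "(real^3 \<Rightarrow> real) \<Rightarrow> real^3 \<Rightarrow> real" where
  "lieN f x = x$2 * pd 1 f x + x$3 * pd 2 f x"

lemma lieN_zero: "lieN (\<lambda>_. 0) = (\<lambda>_. 0)"
  by (simp add: lieN_def fun_eq_iff pd_const)

lemma homog_lieN:
  assumes "homog k f"
  shows "homog k (lieN f)"
proof -
  \<comment> \<open>The predicate replaces degree \<open>k - 1\<close> so that \<open>k = 0\<close>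
    is covered: no exponents are admissible then and the derivative is zero.\<close>
  have "mspan (\<lambda>i j l. Suc (i + j + l) = k) (pd 1 f)"
    by (rule mspan_pd1[OF assms]) (simp add: deg_eq_def)
  from mspan_mult[OF homog_coord[of 2] this, of "deg_eq k"]
  have "homog k (\<lambda>x. x$2 * pd 1 f x)" by (simp add: deg_eq_def)
  moreover have "mspan (\<lambda>i j l. Suc (i + j + l) = k) (pd 2 f)"
    by (rule mspan_pd2[OF assms]) (simp add: deg_eq_def)
  from mspan_mult[OF homog_coord[of 3] this, of "deg_eq k"]
  have "homog k (\<lambda>x. x$3 * pd 2 f x)" by (simp add: deg_eq_def)
  ultimately show ?thesis unfolding lieN_def[abs_def] by (rule mspan_add)
qed

lemma pord0_lieN: "pord 0 f \<Longrightarrow> pord 0 (lieN f)"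
  unfolding lieN_def[abs_def]
  by (intro mspan_add pord_mult_mono[OF pord_coord pord0_pd]) auto

lemma pord0_lieN_pow: "pord 0 f \<Longrightarrow> pord 0 ((lieN ^^ n) f)"
  by (induction n) (simp_all add: pord0_lieN)

lemma homog_lieN_pow: "homog k f \<Longrightarrow> homog k ((lieN ^^ n) f)"
  by (induction n) (simp_all add: homog_lieN)

lemma lieN_add:
  assumes "pord 0 f" "pord 0 g"
  shows "lieN (\<lambda>x. f x + g x) = (\<lambda>x. lieN f x + lieN g x)"
  by (simp add: lieN_def fun_eq_iff pd_add[OF assms] algebra_simps)

lemma lieN_scale: "pord 0 f \<Longrightarrow> lieN (\<lambda>x. c * f x) = (\<lambda>x. c * lieN f x)"
  by (simp add: lieN_def fun_eq_iff pd_scale algebra_simps)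

lemma lieN_pow_add:
  assumes "pord 0 f" "pord 0 g"
  shows "(lieN ^^ n) (\<lambda>x. f x + g x) = (\<lambda>x. (lieN ^^ n) f x + (lieN ^^ n) g x)"
  by (induction n) (simp_all add: lieN_add pord0_lieN_pow assms)

lemma lieN_pow_scale:
  assumes "pord 0 f"
  shows "(lieN ^^ n) (\<lambda>x. c * f x) = (\<lambda>x. c * (lieN ^^ n) f x)"
  by (induction n) (simp_all add: lieN_scale pord0_lieN_pow assms)

text \<open>The commutators of \<open>lieN\<close> with the partial derivatives: differentiating the
  coefficients \<open>x$2\<close> and \<open>x$3\<close> produces \<partial>1 and \<partial>2 as
  extra terms, while \<partial>1 meets no coefficient.\<close>

lemma pd_lieN:
  assumes "pord 0 f"
  shows "pd 1 (lieN f) = lieN (pd 1 f)"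
    "pd 2 (lieN f) = (\<lambda>x. lieN (pd 2 f) x + pd 1 f x)"
    "pd 3 (lieN f) = (\<lambda>x. lieN (pd 3 f) x + pd 2 f x)"
proof -
  have p: "pord 0 (\<lambda>x. x$i)" for i by (rule pord_mono[OF pord_coord]) simp
  have m: "pord 0 (\<lambda>x. x$i * pd j f x)" for i j
    using pord_mult[OF p pord0_pd[OF assms], of i j] by simp
  have "pd i (lieN f) = (\<lambda>x. (x$2 * pd i (pd 1 f) x + (if i = 2 then 1 else 0) * pd 1 f x) +
      (x$3 * pd i (pd 2 f) x + (if i = 3 then 1 else 0) * pd 2 f x))" for i
    unfolding lieN_def[abs_def]
    by (simp add: pd_add[OF m m] pd_mult[OF p pord0_pd[OF assms]] pd_coord)
  then show "pd 1 (lieN f) = lieN (pd 1 f)"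
    "pd 2 (lieN f) = (\<lambda>x. lieN (pd 2 f) x + pd 1 f x)"
    "pd 3 (lieN f) = (\<lambda>x. lieN (pd 3 f) x + pd 2 f x)"
    by (simp_all add: lieN_def fun_eq_iff pd_commute[OF assms, of 2 1]
        pd_commute[OF assms, of 3 1] pd_commute[OF assms, of 3 2])
qed

text \<open>The derivation lowers the weight \<open>2 i + j\<close> of a monomial by one.\<close>

lemma lieN_nilpotent:
  assumes "mspan (\<lambda>i j l. 2 * i + j < n) f"
  shows "(lieN ^^ n) f = (\<lambda>_. 0)"
  using assms
proof (induction n arbitrary: f)
  case 0
  then show ?case by induction (auto simp: fun_eq_iff)
next
  case (Suc n)
  \<comment> \<open>In the first summand \<partial>1 lowers the weight by two and \<open>x$2\<close>
    restores one. In the second, \<partial>2 lowers it by one and \<open>x$3\<close> has weight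
    zero.\<close>
  have "mspan (\<lambda>i j l. 2 * i + j < n) (\<lambda>x. x$2 * pd 1 f x)"
  proof (rule mspan_mult)
    show "mspan (\<lambda>i j l. i = 0 \<and> j = 1) (\<lambda>x. x$2)"
      using mspan_monom[of "\<lambda>i j l. i = 0 \<and> j = 1" 0 1 0 1] by (simp add: monom3_def)
    show "mspan (\<lambda>i j l. 2 * i + j + 1 < n) (pd 1 f)"
      using Suc(2) by (rule mspan_pd1) auto
  qed auto
  moreover have "mspan (\<lambda>i j l. 2 * i + j < n) (\<lambda>x. x$3 * pd 2 f x)"
  proof (rule mspan_mult)
    show "mspan (\<lambda>i j l. i = 0 \<and> j = 0) (\<lambda>x. x$3)"
      using mspan_monom[of "\<lambda>i j l. i = 0 \<and> j = 0" 0 0 1 1] by (simp add: monom3_def)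
    show "mspan (\<lambda>i j l. 2 * i + j < n) (pd 2 f)"
      using Suc(2) by (rule mspan_pd2) auto
  qed auto
  ultimately have "mspan (\<lambda>i j l. 2 * i + j < n) (lieN f)"
    unfolding lieN_def[abs_def] by (rule mspan_add)
  from Suc(1)[OF this] show ?case by (simp add: funpow_swap1)
qed

text \<open>With \<open>h = (u, L u, L\<^sup>2 u)\<close>, \<open>L = lieN\<close>, the divergence of \<open>h\<close> is
  \<open>3 \<partial>\<^sub>1 u + 3 L \<partial>\<^sub>2 u + L\<^sup>2 \<partial>\<^sub>3 u\<close>. Two parameters make the family closed under commutation with \<open>L\<close>.\<close>

definition divop :: "real \<Rightarrow> real \<Rightarrow> (real^3 \<Rightarrow> real) \<Rightarrow> real^3 \<Rightarrow> real" where
  "divop \<alpha> \<beta> u x = \<alpha> * pd 1 u x + \<beta> * lieN (pd 2 u) x + lieN (lieN (pd 3 u)) x"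

lemma divop_add:
  assumes "pord 0 u" "pord 0 w"
  shows "divop \<alpha> \<beta> (\<lambda>x. u x + w x) = (\<lambda>x. divop \<alpha> \<beta> u x + divop \<alpha> \<beta> w x)"
  by (simp add: divop_def fun_eq_iff pd_add[OF assms] lieN_add pord0_lieN pord0_pd assms algebra_simps)

lemma divop_scale:
  assumes "pord 0 u"
  shows "divop \<alpha> \<beta> (\<lambda>x. c * u x) = (\<lambda>x. c * divop \<alpha> \<beta> u x)"
  by (simp add: divop_def fun_eq_iff pd_scale[OF assms] lieN_scale pord0_lieN pord0_pd assms algebra_simps)

text \<open>Moving L past \<partial>2 gives an extra \<beta> L \<partial>1, and past \<partial>3 an
  extra L L \<partial>2. Factoring L out on the left leaves an operator of the same family.\<close>

lemma divop_lieN: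
  assumes "pord 0 u"
  shows "divop \<alpha> \<beta> (lieN u) = lieN (divop (\<alpha> + \<beta>) (\<beta> + 1) u)"
proof -
  note p = pord0_lieN pord0_pd assms mspan_add mspan_scale
  show ?thesis
    by (simp add: divop_def[abs_def] fun_eq_iff pd_lieN[OF assms] lieN_add lieN_scale p algebra_simps)
qed

text \<open>Each passage of L sends (\<alpha>, \<beta>) to (\<alpha> + \<beta>, \<beta> + 1), so
  positivity persists. The conclusion \<open>\<alpha>' > 0\<close> permits the division by \<alpha>
  in \<open>divop_surj\<close>.\<close>

lemma divop_lieN_pow:
  assumes "\<alpha> > 0" "\<beta> > 0"
  shows "\<exists>\<alpha>'>0. \<exists>\<beta>'. \<forall>u. pord 0 u \<longrightarrow> divop \<alpha> \<beta> ((lieN ^^ n) u) = (lieN ^^ n) (divop \<alpha>' \<beta>' u)"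
  using assms
proof (induction n arbitrary: \<alpha> \<beta>)
  case 0
  then show ?case by auto
next
  case (Suc n)
  from Suc(1)[of "\<alpha> + \<beta>" "\<beta> + 1"] Suc(2,3) obtain \<alpha>' \<beta>' where
    "\<alpha>' > 0" "\<And>u. pord 0 u \<Longrightarrow> divop (\<alpha> + \<beta>) (\<beta> + 1) ((lieN ^^ n) u) = (lieN ^^ n) (divop \<alpha>' \<beta>' u)"
    by (meson add_pos_pos zero_less_one)
  then have "\<forall>u. pord 0 u \<longrightarrow> divop \<alpha> \<beta> ((lieN ^^ Suc n) u) = (lieN ^^ Suc n) (divop \<alpha>' \<beta>' u)"
    by (simp add: divop_lieN pord0_lieN_pow)
  with \<open>\<alpha>' > 0\<close> show ?case by blast
qed

text \<open>By downward induction on \<open>n\<close>, the image of \<open>lieN ^^ n\<close> lies in the range of \<open>divop 3 3\<close>.\<close>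

lemma divop_surj:
  assumes "homog k g"
  shows "\<exists>u. homog (Suc k) u \<and> divop 3 3 u = g"
proof -
  \<comment> \<open>A monomial of degree \<open>k\<close> has weight 2 i + j \<le> 2 k, so
    \<open>N\<close> applications of \<open>lieN\<close> annihilate it.\<close>
  define N where "N = Suc (2 * k)"
  have nil: "(lieN ^^ N) g = (\<lambda>_. 0)" if "homog k g" for g
    unfolding N_def using that by (intro lieN_nilpotent) (erule mspan_mono, simp add: deg_eq_def)
  have "\<forall>g. homog k g \<longrightarrow> (\<exists>u. homog (Suc k) u \<and> divop 3 3 u = (lieN ^^ n) g)" if "n \<le> N" for n
    using that
  proof (induction n rule: inc_induct)
    case base
    have "divop 3 3 (\<lambda>_. 0) = (\<lambda>_. 0)" by (simp add: divop_def[abs_def] pd_const lieN_zero)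
    then show ?case using nil mspan_zero by metis
  next
    case (step n)
    show ?case
    proof (intro allI impI)
      fix g assume g: "homog k g"
      from divop_lieN_pow[of 3 3 n] obtain \<alpha> \<beta> where \<alpha>: "\<alpha> > 0"
        and comm: "\<And>u. pord 0 u \<Longrightarrow> divop 3 3 ((lieN ^^ n) u) = (lieN ^^ n) (divop \<alpha> \<beta> u)" by auto
      from pd1_surj[OF g] obtain G where G: "homog (Suc k) G" "pd 1 G = g" by blast
      \<comment> \<open>With \<partial>1 G = g, the operator \<open>divop \<alpha> \<beta>\<close>
        sends G to \<alpha> g + L r. Applying L^n leaves the error L^(n+1) r, which the induction
        hypothesis removes through \<open>w\<close>.\<close>
      define r where "r = (\<lambda>x. \<beta> * pd 2 G x + lieN (pd 3 G) x)"
      have r: "homog k r"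
        unfolding r_def using G(1) by (intro mspan_add mspan_scale homog_lieN homog_pd)
      from step r obtain w where w: "homog (Suc k) w" "divop 3 3 w = (lieN ^^ Suc n) r" by blast
      note p = mspan_pord0[OF G(1)] mspan_pord0[OF w(1)] mspan_pord0[OF g] mspan_pord0[OF r]
      have "divop \<alpha> \<beta> G = (\<lambda>x. \<alpha> * g x + lieN r x)"
        unfolding r_def
        by (simp add: divop_def[abs_def] G(2) lieN_add lieN_scale pord0_lieN pord0_pd mspan_scale p
            algebra_simps)
      then have "divop 3 3 ((lieN ^^ n) G) = (\<lambda>x. \<alpha> * (lieN ^^ n) g x + (lieN ^^ Suc n) r x)"
        using comm[OF p(1)]
        by (simp add: lieN_pow_add lieN_pow_scale mspan_scale pord0_lieN p funpow_swap1)
      moreover have "divop 3 3 (\<lambda>x. (1/\<alpha>) * ((lieN ^^ n) G x + (-1) * w x)) =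
          (\<lambda>x. (1/\<alpha>) * (divop 3 3 ((lieN ^^ n) G) x + (-1) * divop 3 3 w x))"
        by (simp only: divop_scale divop_add mspan_add mspan_scale p pord0_lieN_pow)
      ultimately have "divop 3 3 (\<lambda>x. (1/\<alpha>) * ((lieN ^^ n) G x + (-1) * w x)) = (lieN ^^ n) g"
        using \<alpha> w(2) by simp
      moreover have "homog (Suc k) (\<lambda>x. (1/\<alpha>) * ((lieN ^^ n) G x + (-1) * w x))"
        by (intro mspan_scale mspan_add homog_lieN_pow G w)
      ultimately show "\<exists>u. homog (Suc k) u \<and> divop 3 3 u = (lieN ^^ n) g" by blast
    qed
  qed
  from this[of 0] assms show ?thesis by simp
qed

lemma DERIV_line:
  assumes "mspan A f"
  shows "((\<lambda>t. f (x + t *\<^sub>R h)) has_real_derivative (\<Sum>i\<in>UNIV. pd i f (x + t *\<^sub>R h) * h$i)) (at t)"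
proof -
  have "((\<lambda>t. x + t *\<^sub>R h) has_derivative (\<lambda>s. s *\<^sub>R h)) (at t)"
    by (auto intro!: derivative_eq_intros)
  from has_derivative_compose[OF this mspan_has_derivative[OF assms]]
  have "((\<lambda>t. f (x + t *\<^sub>R h)) has_derivative
      (\<lambda>s. \<Sum>i\<in>UNIV. pd i f (x + t *\<^sub>R h) * (s *\<^sub>R h)$i)) (at t)" .
  then show ?thesis
    unfolding has_field_derivative_def
    by (rule has_derivative_eq_rhs) (simp add: fun_eq_iff sum_distrib_left sum_distrib_right algebra_simps)
qed

text \<open>\<open>q\<close> is constant in the third direction, so it is unchanged when the third
  coordinate is set to 0. That substitution kills every monomial containing
  \<open>x$3\<close>.\<close>

lemma homog_pd3_eq_0:
  assumes "homog k q" and "\<And>x. pd 3 q x = 0"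
  shows "mspan (\<lambda>i j l. i + j = k \<and> l = 0) q"
proof -
  have "q x = q (x + (- x$3) *\<^sub>R axis 3 1)" for x
    using DERIV_isconst_all[of "\<lambda>t. q (x + t *\<^sub>R axis 3 1)" 0 "- x$3"]
      DERIV_line[OF assms(1), of x "axis 3 1"]
    by (simp add: sum_3 assms(2))
  then have eq: "q = (\<lambda>x. q (x + (- x$3) *\<^sub>R axis 3 1))" by blast
  have "mspan (\<lambda>i j l. i + j = k \<and> l = 0) (\<lambda>x. q (x + (- x$3) *\<^sub>R axis 3 1))"
    using assms(1)
  proof induction
    case mspan_zero
    then show ?case by (simp add: mspan.mspan_zero)
  next
    case (mspan_step i j l f c)
    have "mspan (\<lambda>i j l. i + j = k \<and> l = 0) (\<lambda>x. c * monom3 i j l (x + (- x$3) *\<^sub>R axis 3 1))"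
    proof (cases l)
      case 0
      then show ?thesis using mspan_step(1) mspan_monom[of "\<lambda>i j l. i + j = k \<and> l = 0" i j 0 c]
        by (simp add: monom3_def deg_eq_def)
    next
      case (Suc n)
      then show ?thesis by (simp add: monom3_def mspan.mspan_zero)
    qed
    from mspan_add[OF this mspan_step(3)] show ?case .
  qed
  then show ?thesis using eq by simp
qed

text \<open>A componentwise counterpart of \<open>divergence\<close>, suited to calculation with
  \<open>pd\<close>; both are expressed through the Frechet derivative when they are compared in
  \<open>taylor_in_nform\<close>.\<close>

definition vdiv :: "(real^3 \<Rightarrow> real^3) \<Rightarrow> real^3 \<Rightarrow> real" where
  "vdiv w x = pd 1 (\<lambda>x. w x $ 1) x + pd 2 (\<lambda>x. w x $ 2) x + pd 3 (\<lambda>x. w x $ 3) x"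

text \<open>The three equations are the components of R + Dh(x) N x - N h = q e3. The left side is
  what remains in degree \<open>Suc k\<close> after the change of coordinates x + h(x) + ... of a
  field with linear part N x.\<close>

lemma homological_equation:
  assumes R: "\<And>i. homog (Suc k) (\<lambda>x. R x $ i)" and div: "\<And>x. vdiv R x = 0"
  obtains h q where "\<And>i. homog (Suc k) (\<lambda>x. h x $ i)" "\<And>x. vdiv h x = 0"
    "mspan (\<lambda>i j l. i + j = Suc k \<and> l = 0) q"
    "\<And>x. R x $ 1 + lieN (\<lambda>x. h x $ 1) x - h x $ 2 = 0"
    "\<And>x. R x $ 2 + lieN (\<lambda>x. h x $ 2) x - h x $ 3 = 0"
    "\<And>x. R x $ 3 + lieN (\<lambda>x. h x $ 3) x = q x"
proof -
  define R1 R2 R3 where R_defs: "R1 = (\<lambda>x. R x $ 1)" "R2 = (\<lambda>x. R x $ 2)" "R3 = (\<lambda>x. R x $ 3)"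
  have hR: "homog (Suc k) R1" "homog (Suc k) R2" "homog (Suc k) R3"
    unfolding R_defs by (rule R)+
  note pR = hR[THEN mspan_pord0]
  \<comment> \<open>Inserting h2 = L u + R1 and h3 = L h2 + R2 into div h gives
    \<open>divop 3 3 u\<close> plus the bracketed terms in R, so u is chosen to cancel
    these.\<close>
  have "homog k (\<lambda>x. (-1) * (pd 2 R1 x + pd 3 (lieN R1) x + pd 3 R2 x))"
    by (intro mspan_scale mspan_add homog_pd homog_lieN hR)
  from divop_surj[OF this] obtain u where u: "homog (Suc k) u"
    and Tu: "divop 3 3 u = (\<lambda>x. (-1) * (pd 2 R1 x + pd 3 (lieN R1) x + pd 3 R2 x))" by blast
  note pu = mspan_pord0[OF u]
  define h2 where "h2 = (\<lambda>x. lieN u x + R1 x)"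
  define h3 where "h3 = (\<lambda>x. lieN h2 x + R2 x)"
  define q where "q = (\<lambda>x. R3 x + lieN h3 x)"
  have h2: "homog (Suc k) h2" and h3: "homog (Suc k) h3" and q: "homog (Suc k) q"
    unfolding q_def h3_def h2_def by (intro mspan_add homog_lieN u hR)+
  note p = pR pu mspan_pord0[OF h2] mspan_pord0[OF h3] mspan_pord0[OF q] pord0_lieN pord0_pd mspan_add
  define h :: "real^3 \<Rightarrow> real^3" where "h x = vector [u x, h2 x, h3 x]" for x
  have h_nth: "(\<lambda>x. h x $ 1) = u" "(\<lambda>x. h x $ 2) = h2" "(\<lambda>x. h x $ 3) = h3"
    by (simp_all add: h_def)
  have pd_h2: "pd i h2 = (\<lambda>x. pd i (lieN u) x + pd i R1 x)" for i
    unfolding h2_def by (rule pd_add[of "deg_ge 0" _ "deg_ge 0"]) (simp_all add: p)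
  have pd_h3: "pd i h3 = (\<lambda>x. pd i (lieN h2) x + pd i R2 x)" for i
    unfolding h3_def by (rule pd_add[of "deg_ge 0" _ "deg_ge 0"]) (simp_all add: p)
  have pd_q: "pd i q = (\<lambda>x. pd i R3 x + pd i (lieN h3) x)" for i
    unfolding q_def by (rule pd_add[of "deg_ge 0" _ "deg_ge 0"]) (simp_all add: p)
  have divh: "pd 1 u x + pd 2 h2 x + pd 3 h3 x = 0" for x
  proof -
    have "lieN h2 = (\<lambda>x. lieN (lieN u) x + lieN R1 x)"
      unfolding h2_def by (rule lieN_add) (intro p)+
    then have "pd 3 (lieN h2) = (\<lambda>x. pd 3 (lieN (lieN u)) x + pd 3 (lieN R1) x)"
      using pd_add[of "deg_ge 0" "lieN (lieN u)" "deg_ge 0" "lieN R1"] by (simp add: p)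
    then have "pd 1 u x + pd 2 h2 x + pd 3 h3 x =
      divop 3 3 u x + (pd 2 R1 x + pd 3 (lieN R1) x + pd 3 R2 x)"
      by (simp add: pd_h2 pd_h3 divop_def pd_lieN lieN_add p)
    then show ?thesis using fun_cong[OF Tu, of x] by simp
  qed
  have pd_R3: "pd 3 R3 x = - (pd 1 R1 x + pd 2 R2 x)" for x
    using div[of x] unfolding vdiv_def R_defs[symmetric] by linarith
  \<comment> \<open>Commuting \<partial>3 with L gives \<partial>3 q = \<partial>3 R3 + L
    \<partial>3 h3 + \<partial>2 h3. Both \<partial>3 R3 and \<partial>3 h3 are eliminated by the
    vanishing divergences of R and h, and the rest cancels by the definitions of h2 and h3.\<close>
  have "pd 3 q x = 0" for x
  proof -
    have "pd 3 h3 = (\<lambda>x. (-1) * (pd 1 u x + pd 2 h2 x))"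
      by (intro ext) (use divh in \<open>simp add: add_eq_0_iff\<close>)
    then have l: "lieN (pd 3 h3) = (\<lambda>x. (-1) * (lieN (pd 1 u) x + lieN (pd 2 h2) x))"
      by (simp only: lieN_scale lieN_add p)
    have "pd 1 R1 x = pd 1 h2 x - lieN (pd 1 u) x"
      by (simp add: pd_h2 pd_lieN p)
    moreover have "pd 2 R2 x = pd 2 h3 x - lieN (pd 2 h2) x - pd 1 h2 x"
      unfolding pd_h3 using pd_lieN(2)[OF mspan_pord0[OF h2]] by simp
    ultimately show ?thesis
      unfolding pd_q pd_R3 pd_lieN(3)[OF mspan_pord0[OF h3]] l by simp
  qed
  then have "mspan (\<lambda>i j l. i + j = Suc k \<and> l = 0) q"
    by (rule homog_pd3_eq_0[OF q])
  moreover have "homog (Suc k) (\<lambda>x. h x $ i)" for i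
    using exhaust_3[of i] u h2 h3 by (auto simp: h_nth)
  ultimately show thesis
    using that[of h q] divh
    by (simp add: vdiv_def h_nth) (simp add: h_def h2_def h3_def q_def R_defs)
qed

section \<open>Divergence-free fields as sums of shears\<close>

inductive powspan :: "nat \<Rightarrow> (real^3 \<Rightarrow> real) \<Rightarrow> bool" for m where
  powspan_zero: "powspan m (\<lambda>_. 0)"
| powspan_step: "powspan m f \<Longrightarrow> powspan m (\<lambda>x. c * (a \<bullet> x) ^ m + f x)"

lemma powspan_add:
  assumes "powspan m f" "powspan m g"
  shows "powspan m (\<lambda>x. f x + g x)"
  using assms(1)
proof induction
  case (powspan_step f c a)
  from powspan.powspan_step[OF powspan_step(2), of c a] show ?case by (simp add: add.assoc)
qed (use assms(2) in simp)

lemma powspan_sum: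
  "(\<And>s. s \<in> S \<Longrightarrow> powspan m (f s)) \<Longrightarrow> powspan m (\<lambda>x. \<Sum>s\<in>S. f s x)"
  by (induction S rule: infinite_finite_induct) (simp_all add: powspan_zero powspan_add)

text \<open>Take for \<open>w s\<close> the coefficient of degree \<open>j\<close> in the Lagrange
  polynomial of the node \<open>s\<close> among 0, ..., m. Lagrange interpolation reproduces X^i for
  i \<le> m, and comparing coefficients of degree \<open>j\<close> gives the duality.\<close>

lemma vandermonde_dual:
  assumes "j \<le> m"
  obtains w where "\<And>i. i \<le> m \<Longrightarrow> (\<Sum>s\<le>m. w s * real s ^ i) = (if i = j then 1 else 0)"
proof -
  define p where "p s = (\<Prod>r\<in>{..m} - {s}. smult (1 / (real s - real r)) [:- real r, 1:])" for s
  have deg: "degree (p s) \<le> m" if "s \<le> m" for s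
  proof -
    have "degree (p s) \<le> (\<Sum>r\<in>{..m} - {s}. degree (smult (1 / (real s - real r)) [:- real r, 1:]))"
      unfolding p_def by (rule order_trans[OF degree_prod_sum_le]) auto
    also have "\<dots> \<le> (\<Sum>r\<in>{..m} - {s}. 1)" by (intro sum_mono) simp
    also have "\<dots> = m" using that by simp
    finally show ?thesis .
  qed
  have val: "poly (p s) (real t) = (if s = t then 1 else 0)" if "s \<le> m" "t \<le> m" for s t
  proof (cases "s = t")
    case True
    then show ?thesis
      by (auto simp: p_def poly_prod diff_divide_distrib[symmetric] intro!: prod.neutral)
  next
    case False
    then show ?thesis using that by (auto simp: p_def poly_prod)
  qed
  have "(\<Sum>s\<le>m. coeff (p s) j * real s ^ i) = (if i = j then 1 else 0)" if i: "i \<le> m" for i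
  proof -
    \<comment> \<open>Both sides have degree at most \<open>m\<close> and agree at the m + 1
      nodes.\<close>
    have "(\<Sum>s\<le>m. smult (real s ^ i) (p s)) = monom 1 i"
    proof (rule poly_eqI_degree[of "real ` {..m}"])
      have "degree (\<Sum>s\<le>m. smult (real s ^ i) (p s)) \<le> m"
        using deg by (intro degree_sum_le) (auto intro: order_trans[OF degree_smult_le])
      then show "degree (\<Sum>s\<le>m. smult (real s ^ i) (p s)) < card (real ` {..m})"
        by (simp add: card_image)
      show "degree (monom 1 i :: real poly) < card (real ` {..m})"
        using i by (simp add: card_image degree_monom_eq)
      fix x assume "x \<in> real ` {..m}"
      then obtain t where t: "t \<le> m" "x = real t" by auto
      have "(\<Sum>s\<le>m. real s ^ i * poly (p s) x) = (\<Sum>s\<le>m. if s = t then real t ^ i else 0)"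
        using t by (intro sum.cong) (auto simp: val)
      then show "poly (\<Sum>s\<le>m. smult (real s ^ i) (p s)) x = poly (monom 1 i) x"
        using t by (simp add: poly_sum poly_monom)
    qed
    then have "coeff (\<Sum>s\<le>m. smult (real s ^ i) (p s)) j = coeff (monom 1 i) j"
      by simp
    then show ?thesis by (simp add: coeff_sum mult.commute)
  qed
  then show thesis by (rule that)
qed

text \<open>In the binomial expansion of (a + s b)^m, the coefficient of a^(m-t) b^t carries s^t.
  The dual weights isolate t = j, and the binomial coefficient is divided out.\<close>

lemma monomial_eq_sum_powers:
  assumes "i + j = m"
  obtains \<mu> where "\<And>a b :: real. a ^ i * b ^ j = (\<Sum>s\<le>m. \<mu> s * (a + real s * b) ^ m)"
proof -
  obtain w where w: "\<And>i. i \<le> m \<Longrightarrow> (\<Sum>s\<le>m. w s * real s ^ i) = (if i = j then 1 else 0)"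
    using vandermonde_dual[of j m] assms by auto
  have "(\<Sum>s\<le>m. w s * (a + real s * b) ^ m) = real (m choose j) * (a ^ i * b ^ j)" for a b
  proof -
    have "(\<Sum>s\<le>m. w s * (a + real s * b) ^ m) =
        (\<Sum>s\<le>m. \<Sum>t\<le>m. (real (m choose t) * b ^ t * a ^ (m - t)) * (w s * real s ^ t))"
      by (simp add: add.commute[of a] binomial_ring sum_distrib_left power_mult_distrib mult_ac)
    also have "\<dots> = (\<Sum>t\<le>m. (real (m choose t) * b ^ t * a ^ (m - t)) * (\<Sum>s\<le>m. w s * real s ^ t))"
      by (subst sum.swap) (simp add: sum_distrib_left)
    also have "\<dots> = (\<Sum>t\<le>m. if t = j then real (m choose j) * b ^ j * a ^ (m - j) else 0)"
      by (intro sum.cong) (auto simp: w)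
    also have "\<dots> = real (m choose j) * (a ^ i * b ^ j)"
      using assms by (auto simp: mult_ac)
    finally show ?thesis .
  qed
  moreover have "real (m choose j) \<noteq> 0" using assms by auto
  ultimately show thesis
    by (intro that[of "\<lambda>s. w s / real (m choose j)"])
      (simp add: sum_divide_distrib[symmetric])
qed

text \<open>The two-variable identity is used twice: first y^j z^l becomes a combination of powers
  of y + s z, then x^i (y + s z)^(j+l) one of powers of x + t (y + s z).\<close>

lemma homog_powspan:
  assumes "homog m f"
  shows "powspan m f"
  using assms
proof induction
  case mspan_zero
  then show ?case by (simp add: powspan_zero)
next
  case (mspan_step i j l f c)
  then have m: "i + (j + l) = m" by (simp add: deg_eq_def)
  obtain \<mu> where \<mu>: "\<And>a b :: real. a ^ j * b ^ l = (\<Sum>s\<le>j + l. \<mu> s * (a + real s * b) ^ (j + l))"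
    using monomial_eq_sum_powers by blast
  obtain \<nu> where \<nu>: "\<And>a b :: real. a ^ i * b ^ (j + l) = (\<Sum>s\<le>m. \<nu> s * (a + real s * b) ^ m)"
    using monomial_eq_sum_powers[OF m] by blast
  have "c * monom3 i j l x = (\<Sum>s\<le>j + l. \<Sum>t\<le>m.
      (c * \<mu> s * \<nu> t) * (vector [1, real t, real t * real s] \<bullet> x) ^ m)" for x
  proof -
    have "c * monom3 i j l x = c * (\<Sum>s\<le>j + l. \<mu> s * (x$1 ^ i * (x$2 + real s * x$3) ^ (j + l)))"
      by (simp add: monom3_def mult.assoc \<mu> sum_distrib_left mult.left_commute)
    also have "\<dots> = (\<Sum>s\<le>j + l. \<Sum>t\<le>m. (c * \<mu> s * \<nu> t) * (x$1 + real t * (x$2 + real s * x$3)) ^ m)"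
      by (simp add: \<nu> sum_distrib_left mult.assoc)
    finally show ?thesis by (simp add: inner_vec_def sum_3 algebra_simps)
  qed
  moreover have "powspan m (\<lambda>x. \<Sum>s\<le>j + l. \<Sum>t\<le>m.
      (c * \<mu> s * \<nu> t) * (vector [1, real t, real t * real s] \<bullet> x) ^ m)"
    using powspan_step[OF powspan_zero] by (intro powspan_sum) simp
  ultimately show ?case using powspan_add mspan_step(3) by simp
qed

inductive shearsum :: "nat \<Rightarrow> (real^3 \<Rightarrow> real^3) \<Rightarrow> bool" for k where
  shearsum_zero: "shearsum k (\<lambda>_. 0)"
| shearsum_step: "n \<bullet> a = 0 \<Longrightarrow> shearsum k h \<Longrightarrow> shearsum k (\<lambda>x. (n \<bullet> x) ^ k *\<^sub>R a + h x)"

lemma shearsum_add: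
  assumes "shearsum k f" "shearsum k g"
  shows "shearsum k (\<lambda>x. f x + g x)"
  using assms(1)
proof induction
  case (shearsum_step n a h)
  from shearsum.shearsum_step[OF shearsum_step(1,3)] show ?case by (simp add: add.assoc)
qed (use assms(2) in simp)

lemma shearsum_scale:
  assumes "shearsum k f"
  shows "shearsum k (\<lambda>x. c *\<^sub>R f x)"
  using assms
proof induction
  case (shearsum_step n a h)
  from shearsum.shearsum_step[OF _ shearsum_step(3), of n "c *\<^sub>R a"] shearsum_step(1)
  show ?case by (simp add: scaleR_add_right mult.commute)
qed (simp add: shearsum_zero)

definition grad3 :: "(real^3 \<Rightarrow> real) \<Rightarrow> real^3 \<Rightarrow> real^3" where
  "grad3 f x = vector [pd 1 f x, pd 2 f x, pd 3 f x]"

lemma inner_coord: "pord 1 (\<lambda>x. a \<bullet> x)"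
  unfolding inner_vec_def inner_real_def by (intro mspan_sum mspan_scale pord_coord)

lemma powspan_pord: "powspan m f \<Longrightarrow> pord m f"
proof (induction rule: powspan.induct)
  case (powspan_step f c a)
  have "pord (1 * m) (\<lambda>x. (a \<bullet> x) ^ m)" by (intro pord_power inner_coord)
  with powspan_step show ?case by (intro mspan_add mspan_scale) simp_all
qed (rule mspan_zero)

lemma pd_inner_power:
  "pd i (\<lambda>x. (a \<bullet> x) ^ Suc k) x = real (Suc k) * (a \<bullet> x) ^ k * a $ i"
proof -
  have "((\<lambda>x. (a \<bullet> x) ^ Suc k) has_derivative (\<lambda>h. real (Suc k) * (a \<bullet> h) * (a \<bullet> x) ^ k)) (at x)"
    by (rule derivative_eq_intros refl | simp)+
  from pd_eqI[OF this] show ?thesis by (simp add: inner_axis mult_ac)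
qed

text \<open>The expression is the curl of the field f e. For f = (a \<bullet> x)^(k+1) the gradient
  is a multiple of (a \<bullet> x)^k a, and the direction a \<times> e is orthogonal to a, as a
  shear requires.\<close>

lemma shearsum_curl:
  assumes "homog (Suc k) f"
  shows "shearsum k (\<lambda>x. cross3 (grad3 f x) e)"
  using homog_powspan[OF assms]
proof induction
  case powspan_zero
  have "grad3 (\<lambda>_. 0) x = 0" for x
    by (simp add: grad3_def pd_const vec_eq_iff forall_3)
  then show ?case by (simp add: shearsum_zero)
next
  case (powspan_step f c a)
  have "pord 0 (\<lambda>x. (a \<bullet> x) ^ Suc k)"
    by (rule mspan_pord0[OF pord_power[OF inner_coord]])
  then have "grad3 (\<lambda>x. c * (a \<bullet> x) ^ Suc k + f x) x = ((a \<bullet> x) ^ k * (c * real (Suc k))) *\<^sub>R a + grad3 f x" for x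
    using pd_add[OF mspan_scale powspan_pord[OF powspan_step(1)]]
    by (simp add: grad3_def vec_eq_iff forall_3 pd_scale pd_inner_power del: power_Suc of_nat_Suc)
  then have "(\<lambda>x. cross3 (grad3 (\<lambda>x. c * (a \<bullet> x) ^ Suc k + f x) x) e) =
    (\<lambda>x. (a \<bullet> x) ^ k *\<^sub>R ((c * real (Suc k)) *\<^sub>R (cross3 a e)) + cross3 (grad3 f x) e)"
    by (simp add: cross_add_left cross_mult_left del: power_Suc of_nat_Suc)
  moreover have "a \<bullet> ((c * real (Suc k)) *\<^sub>R (cross3 a e)) = 0"
    by (simp add: dot_cross_self)
  ultimately show ?case using shearsum_step[OF _ powspan_step(2)] by presburger
qed

text \<open>A divergence-free homogeneous field \<open>h\<close> of degree \<open>k\<close> has the vector potential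
  \<open>(h \<times> x) / (k + 2)\<close>, by Euler's identity.\<close>

lemma homog_shearsum:
  assumes h: "\<And>i. homog k (\<lambda>x. h x $ i)" and div: "\<And>x. vdiv h x = 0"
  shows "shearsum k h"
proof -
  define A where "A i x = cross3 (h x) x $ i" for i x
  have hc: "homog (Suc k) (\<lambda>x. h x $ i * x $ j)" for i j
    using homog_mult[OF h[of i] homog_coord[of j]] by simp
  have A: "A 1 = (\<lambda>x. h x $ 2 * x $ 3 - h x $ 3 * x $ 2)"
    "A 2 = (\<lambda>x. h x $ 3 * x $ 1 - h x $ 1 * x $ 3)"
    "A 3 = (\<lambda>x. h x $ 1 * x $ 2 - h x $ 2 * x $ 1)"
    by (simp_all add: A_def cross3_def fun_eq_iff)
  have pdA: "pd m (\<lambda>x. h x $ i * x $ j - h x $ i' * x $ j') = (\<lambda>x.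
      (h x $ i * (if m = j then 1 else 0) + pd m (\<lambda>x. h x $ i) x * x $ j) -
      (h x $ i' * (if m = j' then 1 else 0) + pd m (\<lambda>x. h x $ i') x * x $ j'))" for m i j i' j'
    unfolding pd_diff[OF hc hc] pd_mult[OF h homog_coord] pd_coord ..
  have "homog (Suc k) (A i)" for i
    using exhaust_3[of i] by (auto simp: A intro!: mspan_diff hc)
  then have "shearsum k (\<lambda>x. (1 / real (k + 2)) *\<^sub>R
      (cross3 (grad3 (A 1) x) (axis 1 1) + (cross3 (grad3 (A 2) x) (axis 2 1) + cross3 (grad3 (A 3) x) (axis 3 1))))"
    by (intro shearsum_scale shearsum_add shearsum_curl)
  \<comment> \<open>This is curl (h \<times> x) = h div x - x div h + (x \<bullet> grad) h - (h
    \<bullet> grad) x. With div h = 0 and Euler's identity it equals (3 + k - 1) h.\<close>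
  moreover have "cross3 (grad3 (A 1) x) (axis 1 1) + (cross3 (grad3 (A 2) x) (axis 2 1) + cross3 (grad3 (A 3) x) (axis 3 1))
      = real (k + 2) *\<^sub>R h x" for x
  proof -
    have d: "pd 1 (\<lambda>x. h x $ 1) x = - pd 2 (\<lambda>x. h x $ 2) x - pd 3 (\<lambda>x. h x $ 3) x"
      using div[of x] by (simp add: vdiv_def)
    show ?thesis
      using euler_homog[OF h[of 1], of x] euler_homog[OF h[of 2], of x] euler_homog[OF h[of 3], of x]
      by (simp add: vec_eq_iff forall_3 cross3_def grad3_def A pdA d) (simp add: algebra_simps)
  qed
  ultimately show ?thesis by simp
qed

section \<open>Polynomial vector fields and compositions of shears\<close>

abbreviation pordv :: "nat \<Rightarrow> (real^3 \<Rightarrow> real^3) \<Rightarrow> bool" where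
  "pordv m w \<equiv> \<forall>i. pord m (\<lambda>x. w x $ i)"

lemma pordv_has_derivative:
  assumes "pordv m w"
  shows "(w has_derivative (\<lambda>h. \<chi> i. \<Sum>j\<in>UNIV. pd j (\<lambda>x. w x $ i) x * h$j)) (at x)"
proof (subst has_derivative_componentwise_within, intro ballI)
  fix b :: "real^3" assume "b \<in> Basis"
  then obtain i where b: "b = axis i 1" by (auto simp: Basis_vec_def)
  show "((\<lambda>x. w x \<bullet> b) has_derivative
      (\<lambda>h. (\<chi> i. \<Sum>j\<in>UNIV. pd j (\<lambda>x. w x $ i) x * h$j) \<bullet> b)) (at x)"
    using mspan_has_derivative[of "deg_ge m" "\<lambda>x. w x $ i" x] assms by (simp add: b inner_axis)
qed

lemma pordv_frechet:
  "pordv m w \<Longrightarrow> frechet_derivative w (at x) h $ i = (\<Sum>j\<in>UNIV. pd j (\<lambda>x. w x $ i) x * h$j)"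
  by (simp add: frechet_derivative_at[OF pordv_has_derivative, symmetric])

lemma pordv_frechet_works:
  "pordv m w \<Longrightarrow> (w has_derivative frechet_derivative w (at x)) (at x)"
  using pordv_has_derivative frechet_derivative_works differentiable_def by blast

lemma pordv_Ck_on: "pordv 0 w \<Longrightarrow> Ck_on k S w"
proof (induction k arbitrary: w)
  case 0
  have "continuous_on S w"
    using pordv_has_derivative[OF 0]
    by (intro continuous_at_imp_continuous_on ballI has_derivative_continuous)
  then show ?case by simp
next
  case (Suc k)
  have "w differentiable_on S"
    using pordv_has_derivative[OF Suc(2)]
    by (auto simp: differentiable_on_def differentiable_def intro: has_derivative_at_withinI)
  moreover have "Ck_on k S (\<lambda>x. frechet_derivative w (at x) b)" for b
    unfolding pordv_frechet[OF Suc(2)]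
    using Suc(2) by (intro Suc(1) allI) (auto simp: pordv_frechet mult.commute[of _ "b $ _"]
        intro!: mspan_sum mspan_scale pord0_pd)
  ultimately show ?case by simp
qed

lemma pordv_smooth_on: "pordv 0 w \<Longrightarrow> smooth_on S w"
  by (simp add: smooth_on_def pordv_Ck_on)

lemma vdiv_eqI:
  assumes "(w has_derivative B) (at x)"
  shows "vdiv w x = B (axis 1 1) $ 1 + B (axis 2 1) $ 2 + B (axis 3 1) $ 3"
proof -
  have "pd i (\<lambda>x. w x $ i) x = B (axis i 1) $ i" for i
    by (rule pd_eqI[OF bounded_linear.has_derivative[OF bounded_linear_vec_nth assms]])
  then show ?thesis by (simp add: vdiv_def)
qed

section \<open>Shears, their compositions and the transport of vector fields\<close>

definition shear :: "real^3 \<Rightarrow> real^3 \<Rightarrow> nat \<Rightarrow> real^3 \<Rightarrow> real^3" where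
  "shear n a k x = x + (n \<bullet> x) ^ k *\<^sub>R a"

text \<open>Since n \<bullet> a = 0, the shear preserves n \<bullet> x, so the opposite displacement
  has the same coefficient and cancels it.\<close>

lemma shear_inverse:
  assumes "n \<bullet> a = 0"
  shows "shear n (- a) k (shear n a k x) = x" "shear n a k (shear n (- a) k x) = x"
  using assms by (simp_all add: shear_def inner_right_distrib inner_diff_right)

lemma shear_has_derivative:
  "(shear n a k has_derivative (\<lambda>h. h + (real k * (n \<bullet> x) ^ (k - 1) * (n \<bullet> h)) *\<^sub>R a)) (at x)"
  unfolding shear_def
  by (rule derivative_eq_intros refl | simp add: algebra_simps)+

lemma inner_coord_compose:
  assumes "pordv m w"
  shows "pord m (\<lambda>x. n \<bullet> w x)"
  unfolding inner_vec_def inner_real_def using assms by (intro mspan_sum mspan_scale) simp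

lemma pord_inner_power: "pord k (\<lambda>x. (n \<bullet> x) ^ k)"
  using pord_power[OF inner_coord, of k n] by simp

lemma shear_pord: "pord k (\<lambda>x. shear n a k x $ i - x $ i)"
  using mspan_scale[OF pord_inner_power[of k n], of "a $ i"] by (simp add: shear_def mult.commute)

lemma pord_near_id:
  assumes "\<forall>i. pord 2 (\<lambda>x. \<psi> x $ i - x $ i)"
  shows "pord 1 (\<lambda>x. \<psi> x $ i)"
  using mspan_add[OF pord_mono[OF assms[rule_format, of i]] pord_coord[of i]] by simp

lemma pord_near_id_compose:
  assumes "\<forall>i. pord 2 (\<lambda>x. \<psi> x $ i - x $ i)" "\<forall>i. pord 2 (\<lambda>x. \<phi> x $ i - x $ i)"
  shows "pord 2 (\<lambda>x. \<psi> (\<phi> x) $ i - x $ i)"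
  using mspan_add[OF pord_compose[OF assms(1)[rule_format, of i] pord_near_id[OF assms(2)]]
      assms(2)[rule_format, of i]] by simp

text \<open>The inverse is built along with the map, so it is polynomial by construction. The bound
  \<open>2 \<le> k\<close> makes both maps near-identity.\<close>

inductive shearcomp :: "(real^3 \<Rightarrow> real^3) \<Rightarrow> (real^3 \<Rightarrow> real^3) \<Rightarrow> bool" where
  shearcomp_id: "shearcomp (\<lambda>x. x) (\<lambda>x. x)"
| shearcomp_step: "n \<bullet> a = 0 \<Longrightarrow> 2 \<le> k \<Longrightarrow> shearcomp \<psi> \<phi> \<Longrightarrow>
    shearcomp (\<lambda>x. shear n a k (\<psi> x)) (\<lambda>x. \<phi> (shear n (- a) k x))"

lemma shearcomp_compose:
  assumes "shearcomp \<psi> \<phi>" "shearcomp \<psi>' \<phi>'"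
  shows "shearcomp (\<lambda>x. \<psi> (\<psi>' x)) (\<lambda>x. \<phi>' (\<phi> x))"
  using assms(1)
proof induction
  case shearcomp_id
  then show ?case using assms(2) by simp
next
  case (shearcomp_step n a k \<psi> \<phi>)
  from shearcomp.shearcomp_step[OF shearcomp_step(1,2,4)] show ?case .
qed

lemma shearcomp_inverse:
  assumes "shearcomp \<psi> \<phi>"
  shows "\<phi> (\<psi> x) = x" "\<psi> (\<phi> x) = x"
  using assms by (induction arbitrary: x) (simp_all add: shear_inverse)

lemma shearcomp_near_id:
  assumes "shearcomp \<psi> \<phi>"
  shows "(\<forall>i. pord 2 (\<lambda>x. \<psi> x $ i - x $ i)) \<and> (\<forall>i. pord 2 (\<lambda>x. \<phi> x $ i - x $ i))"
  using assms
proof induction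
  case shearcomp_id
  then show ?case by (simp add: mspan_zero)
next
  case (shearcomp_step n a k \<psi> \<phi>)
  have "\<forall>i. pord 2 (\<lambda>x. shear n b k x $ i - x $ i)" for b
    using pord_mono[OF shear_pord shearcomp_step(2)] by simp
  with shearcomp_step show ?case by (simp add: pord_near_id_compose)
qed

lemma shearcomp_pordv:
  assumes "shearcomp \<psi> \<phi>"
  shows "pordv 1 \<psi>" "pordv 1 \<phi>" "pordv 0 \<psi>" "pordv 0 \<phi>"
proof -
  show "pordv 1 \<psi>" "pordv 1 \<phi>"
    using pord_near_id shearcomp_near_id[OF assms] by blast+
  then show "pordv 0 \<psi>" "pordv 0 \<phi>" by (auto intro: mspan_pord0)
qed

lemma shearcomp_frechet_step:
  assumes "shearcomp \<psi> \<phi>"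
  shows "frechet_derivative (\<lambda>x. shear n a k (\<psi> x)) (at x) =
    (\<lambda>h. h + (real k * (n \<bullet> \<psi> x) ^ (k - 1) * (n \<bullet> h)) *\<^sub>R a) \<circ> frechet_derivative \<psi> (at x)"
  using has_derivative_compose[OF pordv_frechet_works[OF shearcomp_pordv(1)[OF assms]] shear_has_derivative]
  by (intro frechet_derivative_at[symmetric]) (simp add: o_def)

text \<open>The derivative of a shear is the identity plus a rank-one matrix c a n^T, of determinant
  1 + c (n \<bullet> a) = 1; the chain rule multiplies these determinants.\<close>

lemma shearcomp_det:
  assumes "shearcomp \<psi> \<phi>"
  shows "det (jacobian \<psi> x) = 1"
  using assms
proof induction
  case shearcomp_id
  have "matrix (\<lambda>x::real^3. x) = mat 1" using matrix_id_mat_1 by (simp add: id_def)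
  then show ?case by (simp add: jacobian_def)
next
  case (shearcomp_step n a k \<psi> \<phi>)
  define c where "c = real k * (n \<bullet> \<psi> x) ^ (k - 1)"
  define S where "S = (\<lambda>h. h + (c * (n \<bullet> h)) *\<^sub>R a)"
  have S: "linear S"
    unfolding S_def by (auto intro!: linearI simp: inner_right_distrib algebra_simps)
  have F: "linear (frechet_derivative \<psi> (at x))"
    using pordv_frechet_works[OF shearcomp_pordv(1)[OF shearcomp_step(3)]] has_derivative_linear by blast
  have "a $ 1 * n $ 1 + a $ 2 * n $ 2 + a $ 3 * n $ 3 = 0"
    using shearcomp_step(1) by (simp add: inner_vec_def sum_3 mult.commute)
  moreover have "det (matrix S) = 1 + c * (a $ 1 * n $ 1 + a $ 2 * n $ 2 + a $ 3 * n $ 3)"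
    by (simp add: det_3 matrix_def S_def inner_axis algebra_simps)
  ultimately have "det (matrix S) = 1" by simp
  moreover have "jacobian (\<lambda>x. shear n a k (\<psi> x)) x = matrix S ** jacobian \<psi> x"
    unfolding jacobian_def shearcomp_frechet_step[OF shearcomp_step(3)]
    using matrix_compose[OF F S] by (simp add: S_def c_def)
  ultimately show ?case using shearcomp_step(4) by (simp add: det_mul)
qed

text \<open>The transformed field is polynomial because the inverse shear is. Its divergence is
  carried along as a scalar function, as expected of a volume-preserving map; this is checked by a
  trace computation.\<close>

lemma shear_push:
  assumes na: "n \<bullet> a = 0" and w: "pordv 0 w"
  obtains w' where "pordv 0 w'"
    "\<And>x. w' (shear n a k x) = w x + (real k * (n \<bullet> x) ^ (k - 1) * (n \<bullet> w x)) *\<^sub>R a"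
    "\<And>x. vdiv w' (shear n a k x) = vdiv w x"
proof -
  define W where "W x = w (shear n (- a) k x)" for x
  define w' where "w' x = W x + (real k * (n \<bullet> x) ^ (k - 1) * (n \<bullet> W x)) *\<^sub>R a" for x
  have sh: "pord 0 (\<lambda>x. shear n (- a) k x $ i)" for i
    using mspan_add[OF mspan_pord0[OF shear_pord[of k n "- a" i]] mspan_pord0[OF pord_coord[of i]]] by simp
  have W: "pordv 0 W"
    unfolding W_def using pord_compose0[OF _ sh] w by blast
  have p: "pord 0 (\<lambda>x. n \<bullet> W x)" "pord 0 (\<lambda>x. (n \<bullet> x) ^ (k - 1))"
    using inner_coord_compose[OF W] mspan_pord0[OF pord_inner_power] by auto
  have "pord 0 (\<lambda>x. W x $ i + (a $ i * real k) * ((n \<bullet> x) ^ (k - 1) * (n \<bullet> W x)))" for i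
    using W mspan_pord0[OF pord_mult[OF p(2,1)]] by (intro mspan_add mspan_scale) auto
  then have w': "pordv 0 w'" by (simp add: w'_def mult_ac)
  have val: "w' (shear n a k x) = w x + (real k * (n \<bullet> x) ^ (k - 1) * (n \<bullet> w x)) *\<^sub>R a" for x
    using na by (simp add: w'_def W_def shear_inverse) (simp add: shear_def inner_right_distrib)
  have "vdiv w' y = vdiv w (shear n (- a) k y)" for y
  proof -
    define B where "B = frechet_derivative w (at (shear n (- a) k y))"
    define c where "c = real k * (n \<bullet> y) ^ (k - 1)"
    define d where "d = real k * (real (k - 1) * (n \<bullet> y) ^ (k - 1 - 1))"
    have B: "(w has_derivative B) (at (shear n (- a) k y))"
      unfolding B_def by (rule pordv_frechet_works[OF w])
    interpret B: linear B using B by (rule has_derivative_linear)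
    define DW where "DW h = B (h - (c * (n \<bullet> h)) *\<^sub>R a)" for h
    have DW: "(W has_derivative DW) (at y)"
      using has_derivative_compose[OF shear_has_derivative B]
      unfolding W_def DW_def c_def by simp
    have "(w' has_derivative (\<lambda>h. DW h + (c * (n \<bullet> DW h) + d * (n \<bullet> h) * (n \<bullet> W y)) *\<^sub>R a)) (at y)"
      unfolding w'_def c_def d_def
      by (rule derivative_eq_intros DW refl | simp add: algebra_simps)+
    \<comment> \<open>The derivative of \<open>w'\<close> is (I + c a n^T) B (I - c a n^T) plus a
      multiple of a n^T. The product is conjugate to B, as n \<bullet> a = 0 makes the outer factors
      inverse to each other, and the extra term has trace a multiple of n \<bullet> a.\<close>
    from vdiv_eqI[OF this] vdiv_eqI[OF B]
    have e: "vdiv w' y - vdiv w (shear n (- a) k y) =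
        (DW (axis 1 1) $ 1 - B (axis 1 1) $ 1) + (DW (axis 2 1) $ 2 - B (axis 2 1) $ 2)
        + (DW (axis 3 1) $ 3 - B (axis 3 1) $ 3)
        + c * (n \<bullet> (a $ 1 *\<^sub>R DW (axis 1 1) + a $ 2 *\<^sub>R DW (axis 2 1) + a $ 3 *\<^sub>R DW (axis 3 1)))
        + d * (n \<bullet> W y) * (n \<bullet> a)"
      by (simp add: inner_right_distrib inner_axis) (simp add: inner_vec_def sum_3 algebra_simps)
    have Ba: "a $ 1 *\<^sub>R DW (axis 1 1) + a $ 2 *\<^sub>R DW (axis 2 1) + a $ 3 *\<^sub>R DW (axis 3 1) = B a"
    proof -
      have a: "a = a $ 1 *\<^sub>R axis 1 1 + a $ 2 *\<^sub>R axis 2 1 + a $ 3 *\<^sub>R axis 3 1"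
        by (simp add: vec_eq_iff forall_3)
      have "linear DW"
        unfolding DW_def by (auto intro!: linearI simp: inner_right_distrib B.diff B.add B.scale algebra_simps)
      then have "DW a = a $ 1 *\<^sub>R DW (axis 1 1) + a $ 2 *\<^sub>R DW (axis 2 1) + a $ 3 *\<^sub>R DW (axis 3 1)"
        by (subst a) (simp add: linear_add linear_scale)
      then show ?thesis using na by (simp add: DW_def)
    qed
    have DWc: "DW (axis i 1) $ j = B (axis i 1) $ j - c * n $ i * B a $ j" for i j
      by (simp add: DW_def B.diff B.scale inner_axis)
    have "n \<bullet> B a = n $ 1 * B a $ 1 + n $ 2 * B a $ 2 + n $ 3 * B a $ 3"
      by (simp add: inner_vec_def sum_3)
    then show ?thesis using e[unfolded Ba DWc] na by (simp add: algebra_simps)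
  qed
  then show thesis using that[OF w' val] na by (simp add: shear_inverse)
qed

lemma shearcomp_push:
  assumes "shearcomp \<psi> \<phi>" and "pordv 0 w"
  shows "\<exists>w'. pordv 0 w' \<and> (\<forall>x. w' (\<psi> x) = frechet_derivative \<psi> (at x) (w x)) \<and>
    (\<forall>x. vdiv w' (\<psi> x) = vdiv w x)"
  using assms(1)
proof induction
  case shearcomp_id
  then show ?case using assms(2) by (intro exI[of _ w]) simp
next
  case (shearcomp_step n a k \<psi> \<phi>)
  then obtain w1 where w1: "pordv 0 w1" "\<And>x. w1 (\<psi> x) = frechet_derivative \<psi> (at x) (w x)"
    "\<And>x. vdiv w1 (\<psi> x) = vdiv w x" by blast
  obtain w2 where "pordv 0 w2"
    "\<And>x. w2 (shear n a k x) = w1 x + (real k * (n \<bullet> x) ^ (k - 1) * (n \<bullet> w1 x)) *\<^sub>R a"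
    "\<And>x. vdiv w2 (shear n a k x) = vdiv w1 x"
    using shear_push[OF shearcomp_step(1) w1(1)] by blast
  then show ?case
    by (intro exI[of _ w2]) (simp add: w1 shearcomp_frechet_step[OF shearcomp_step(3)])
qed

text \<open>One shear is composed for each summand. The leading terms add up, because evaluating (n
  \<bullet> x)^k at \<psi>(x) instead of x changes it only at order k + 1.\<close>

lemma shearsum_realize:
  assumes "shearsum k h" "2 \<le> k"
  shows "pordv k h \<and> (\<exists>\<psi> \<phi>. shearcomp \<psi> \<phi> \<and> (\<forall>i. pord (Suc k) (\<lambda>x. \<psi> x $ i - x $ i - h x $ i)))"
  using assms(1)
proof induction
  case shearsum_zero
  show ?case
    by (intro conjI exI[of _ "\<lambda>x. x"]) (simp_all add: mspan_zero shearcomp_id)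
next
  case (shearsum_step n a h)
  then obtain \<psi> \<phi> where \<psi>: "shearcomp \<psi> \<phi>" "\<And>i. pord (Suc k) (\<lambda>x. \<psi> x $ i - x $ i - h x $ i)"
    by blast
  have id2: "\<And>i. pord 2 (\<lambda>x. \<psi> x $ i - x $ i)" using shearcomp_near_id[OF \<psi>(1)] by blast
  have d: "pord (Suc k) (\<lambda>x. (n \<bullet> \<psi> x) ^ k - (n \<bullet> x) ^ k)"
    by (rule pord_compose_diff[OF pord_inner_power id2]) simp_all
  have "pord (Suc k) (\<lambda>x. shear n a k (\<psi> x) $ i - x $ i - ((n \<bullet> x) ^ k *\<^sub>R a + h x) $ i)" for i
    using mspan_add[OF \<psi>(2)[of i] mspan_scale[OF d, of "a $ i"]]
    by (simp add: shear_def algebra_simps)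
  moreover have "pordv k (\<lambda>x. (n \<bullet> x) ^ k *\<^sub>R a + h x)"
    using shearsum_step(3) mspan_add[OF mspan_scale[OF pord_inner_power]]
    by (simp add: mult.commute)
  ultimately show ?case
    using shearcomp_step[OF shearsum_step(1) assms(2) \<psi>(1)] by blast
qed

section \<open>Taylor polynomials\<close>

lemma norm_diff_le_of_deriv_le:
  fixes g :: "real \<Rightarrow> 'a::real_normed_vector"
  assumes "\<And>s. s \<in> closed_segment a b \<Longrightarrow> (g has_vector_derivative g' s) (at s)"
    and "\<And>s. s \<in> closed_segment a b \<Longrightarrow> norm (g' s) \<le> B"
  shows "norm (g b - g a) \<le> B * \<bar>b - a\<bar>"
proof -
  have "norm (g b - g a) \<le> B * norm (b - a)"
  proof (rule differentiable_bound[of "closed_segment a b" g "\<lambda>s h. h *\<^sub>R g' s"])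
    fix s assume s: "s \<in> closed_segment a b"
    show "(g has_derivative (\<lambda>h. h *\<^sub>R g' s)) (at s within closed_segment a b)"
      using assms(1)[OF s] by (auto simp: has_vector_derivative_def intro: has_derivative_at_withinI)
    show "onorm (\<lambda>h. h *\<^sub>R g' s) \<le> B"
      using assms(2)[OF s] by (intro onorm_le) (simp add: mult.commute[of B] mult_left_mono)
  qed auto
  then show ?thesis by simp
qed

lemma isCont_norm_bound:
  assumes "isCont f (0 :: 'a::real_normed_vector)"
  shows "\<exists>r>0. \<forall>x. norm x < r \<longrightarrow> norm (f x - f 0 :: 'b::real_normed_vector) < 1"
  using assms[unfolded continuous_at_eps_delta, rule_format, of 1]
  by (auto simp: dist_norm)

lemma has_vector_derivative_line:
  assumes "(f has_derivative f') (at (x + s *\<^sub>R b))"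
  shows "((\<lambda>s. f (x + s *\<^sub>R b)) has_vector_derivative f' b) (at s)"
proof -
  interpret linear f' using assms by (rule has_derivative_linear)
  have "((\<lambda>s. x + s *\<^sub>R b) has_derivative (\<lambda>h. h *\<^sub>R b)) (at s)"
    by (auto intro!: derivative_eq_intros)
  from has_derivative_compose[OF this assms] show ?thesis
    by (simp add: has_vector_derivative_def scale)
qed

lemma Ck_on_frechet:
  assumes "Ck_on (Suc k) U f" "open U" "x \<in> U"
  shows "(f has_derivative frechet_derivative f (at x)) (at x)"
  using assms by (auto simp: differentiable_on_eq_differentiable_at frechet_derivative_works[symmetric])

text \<open>On the ray t x a monomial of degree d is t^d times its value at x, so multiplying it by
  \<open>x$i\<close> and dividing by d + 1 gives the primitive. The result is again polynomial in
  x.\<close>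

lemma radial_primitive:
  assumes "pord 0 g"
  shows "\<exists>G. pord 0 G \<and> G 0 = 0 \<and>
    (\<forall>x t. ((\<lambda>t. G (t *\<^sub>R x)) has_real_derivative x$i * g (t *\<^sub>R x)) (at t))"
  using assms
proof induction
  case mspan_zero
  then show ?case by (intro exI[of _ "\<lambda>_. 0"]) (simp add: mspan.mspan_zero)
next
  case (mspan_step i' j l g c)
  then obtain G where G: "pord 0 G" "G 0 = 0"
    "\<And>x t. ((\<lambda>t. G (t *\<^sub>R x)) has_real_derivative x$i * g (t *\<^sub>R x)) (at t)" by blast
  define d where "d = i' + j + l"
  have scale: "monom3 i' j l (t *\<^sub>R x) = t ^ d * monom3 i' j l x" for t x
    by (simp add: monom3_def d_def power_add power_mult_distrib mult_ac)
  define H where "H x = c / real (Suc d) * (x$i * monom3 i' j l x) + G x" for x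
  have "pord 0 H"
    unfolding H_def[abs_def]
    by (intro mspan_add mspan_scale pord_mult_mono[OF pord_coord mspan_monom3] G) simp
  moreover have "H 0 = 0" by (simp add: H_def G)
  moreover have "((\<lambda>t. H (t *\<^sub>R x)) has_real_derivative
      x$i * (c * monom3 i' j l (t *\<^sub>R x) + g (t *\<^sub>R x))) (at t)" for x t
  proof -
    have "((\<lambda>t. c / real (Suc d) * (x$i * monom3 i' j l x) * t ^ Suc d + G (t *\<^sub>R x)) has_real_derivative
        c / real (Suc d) * (x$i * monom3 i' j l x) * (real (Suc d) * t ^ d) + x$i * g (t *\<^sub>R x)) (at t)"
      by (rule derivative_eq_intros G refl | simp)+
    then show ?thesis by (simp add: H_def scale algebra_simps del: of_nat_Suc)
  qed
  ultimately show ?case by blast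
qed

text \<open>Induction on the smoothness: the partial derivatives are approximated to order
  \<open>m\<close> and integrated along rays from 0. Bounding the difference along the ray by the
  mean value inequality gains one factor of the norm.\<close>

lemma taylor_polynomial:
  fixes f :: "real^3 \<Rightarrow> real^3"
  assumes U: "open U" "0 \<in> U" and "Ck_on m U f"
  shows "\<exists>P C r. pordv 0 P \<and> 0 < r \<and> (\<forall>x. norm x < r \<longrightarrow> norm (f x - P x) \<le> C * norm x ^ m)"
  using assms(3)
proof (induction m arbitrary: f)
  case 0
  then have "isCont f 0" using U by (simp add: continuous_on_eq_continuous_at)
  then obtain r where "r > 0" "\<And>x. norm x < r \<Longrightarrow> norm (f x - f 0) < 1"
    using isCont_norm_bound by blast
  then show ?case
    by (intro exI[of _ "\<lambda>_. f 0"] exI[of _ 1] exI[of _ r]) (auto simp: pord_const less_imp_le)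
next
  case (Suc m)
  define F where "F i x = frechet_derivative f (at x) (axis i 1)" for i x
  have "Ck_on m U (F i)" for i
    using Suc(2) by (simp add: F_def[abs_def])
  then have "\<forall>i. \<exists>P C r. pordv 0 P \<and> 0 < r \<and> (\<forall>x. norm x < r \<longrightarrow> norm (F i x - P x) \<le> C * norm x ^ m)"
    using Suc(1) by blast
  then obtain P C r where P: "\<And>i. pordv 0 (P i)" and r: "\<And>i::3. 0 < r i"
    and bd: "\<And>i x. norm x < r i \<Longrightarrow> norm (F i x - P i x) \<le> C i * norm x ^ m"
    by metis
  have "\<forall>i j. \<exists>G. pord 0 G \<and> G 0 = 0 \<and>
      (\<forall>x t. ((\<lambda>t. G (t *\<^sub>R x)) has_real_derivative x$i * P i (t *\<^sub>R x) $ j) (at t))"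
    using radial_primitive P by blast
  then obtain G where G: "\<And>i j. pord 0 (G i j)" "\<And>i j. G i j 0 = 0"
    "\<And>i j x t. ((\<lambda>t. G i j (t *\<^sub>R x)) has_real_derivative x$i * P i (t *\<^sub>R x) $ j) (at t)"
    by metis
  \<comment> \<open>\<open>Q\<close> agrees with f at 0, and its derivative along a ray is that of f
    with each partial derivative replaced by its polynomial approximation
    \<open>P i\<close>.\<close>
  define Q :: "real^3 \<Rightarrow> real^3" where "Q x = (\<chi> j. f 0 $ j + (\<Sum>i\<in>UNIV. G i j x))" for x
  have Q: "pordv 0 Q"
    by (auto simp: Q_def intro!: mspan_add mspan_sum pord_const G)
  have Q0: "Q 0 = f 0" by (simp add: Q_def G vec_eq_iff)
  have dQ: "((\<lambda>t. Q (t *\<^sub>R x)) has_vector_derivative (\<Sum>i\<in>UNIV. x$i *\<^sub>R P i (t *\<^sub>R x))) (at t)" for x t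
    unfolding has_vector_derivative_def
  proof (subst has_derivative_componentwise_within, intro ballI)
    fix b :: "real^3" assume "b \<in> Basis"
    then obtain j where b: "b = axis j 1" by (auto simp: Basis_vec_def)
    have "((\<lambda>t. f 0 $ j + (\<Sum>i\<in>UNIV. G i j (t *\<^sub>R x))) has_real_derivative
        (\<Sum>i\<in>UNIV. x$i * P i (t *\<^sub>R x) $ j)) (at t)"
      by (rule derivative_eq_intros G refl | simp)+
    then show "((\<lambda>t. Q (t *\<^sub>R x) \<bullet> b) has_derivative
        (\<lambda>h. (h *\<^sub>R (\<Sum>i\<in>UNIV. x$i *\<^sub>R P i (t *\<^sub>R x))) \<bullet> b)) (at t)"
      by (simp add: has_field_derivative_def b inner_axis Q_def sum_component)
        (simp add: mult_commute_abs)
  qed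
  from U obtain r0 where r0: "r0 > 0" "ball 0 r0 \<subseteq> U" by (meson openE)
  define \<rho> where "\<rho> = Min (insert r0 (range r))"
  have \<rho>: "0 < \<rho>" "\<rho> \<le> r0" "\<And>i. \<rho> \<le> r i"
    using r0 r by (simp_all add: \<rho>_def) (simp add: min.coboundedI2)
  have "norm (f x - Q x) \<le> (\<Sum>i\<in>UNIV. \<bar>C i\<bar>) * norm x ^ Suc m" if x: "norm x < \<rho>" for x
  proof -
    have "norm ((f (1 *\<^sub>R x) - Q (1 *\<^sub>R x)) - (f (0 *\<^sub>R x) - Q (0 *\<^sub>R x)))
        \<le> ((\<Sum>i\<in>UNIV. \<bar>C i\<bar>) * norm x ^ Suc m) * \<bar>1 - 0\<bar>"
    proof (rule norm_diff_le_of_deriv_le)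
      fix t :: real assume "t \<in> closed_segment 0 1"
      then have t: "0 \<le> t" "t \<le> 1" by (auto simp: closed_segment_eq_real_ivl)
      have tx: "norm (t *\<^sub>R x) \<le> norm x" using t by (simp add: mult_left_le_one_le)
      then have txU: "t *\<^sub>R x \<in> U" using x \<rho>(2) r0 by auto
      have lin: "frechet_derivative f (at (t *\<^sub>R x)) x = (\<Sum>i\<in>UNIV. x$i *\<^sub>R F i (t *\<^sub>R x))"
      proof -
        interpret linear "frechet_derivative f (at (t *\<^sub>R x))"
          using Ck_on_frechet[OF Suc(2) U(1) txU] by (rule has_derivative_linear)
        have "x = (\<Sum>i\<in>UNIV. x$i *\<^sub>R axis i 1)"
          by (simp add: vec_eq_iff forall_3 sum_3)
        then have "frechet_derivative f (at (t *\<^sub>R x)) x =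
            frechet_derivative f (at (t *\<^sub>R x)) (\<Sum>i\<in>UNIV. x$i *\<^sub>R axis i 1)" by simp
        then show ?thesis by (simp add: sum scale F_def)
      qed
      have "((\<lambda>t. f (t *\<^sub>R x)) has_vector_derivative (\<Sum>i\<in>UNIV. x$i *\<^sub>R F i (t *\<^sub>R x))) (at t)"
        using has_vector_derivative_line[of f "frechet_derivative f (at (t *\<^sub>R x))" 0 t x]
          Ck_on_frechet[OF Suc(2) U(1) txU] lin by simp
      from has_vector_derivative_diff[OF this dQ]
      show "((\<lambda>t. f (t *\<^sub>R x) - Q (t *\<^sub>R x)) has_vector_derivative
          (\<Sum>i\<in>UNIV. x$i *\<^sub>R (F i (t *\<^sub>R x) - P i (t *\<^sub>R x)))) (at t)"
        by (simp add: scaleR_diff_right sum_subtractf)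
      show "norm (\<Sum>i\<in>UNIV. x$i *\<^sub>R (F i (t *\<^sub>R x) - P i (t *\<^sub>R x)))
          \<le> (\<Sum>i\<in>UNIV. \<bar>C i\<bar>) * norm x ^ Suc m"
        unfolding sum_distrib_right
      proof (rule order_trans[OF norm_sum], rule sum_mono)
        fix i
        have "norm (F i (t *\<^sub>R x) - P i (t *\<^sub>R x)) \<le> C i * norm (t *\<^sub>R x) ^ m"
          using tx x \<rho>(3)[of i] by (intro bd) linarith
        also have "\<dots> \<le> \<bar>C i\<bar> * norm x ^ m"
          using tx by (intro mult_mono power_mono) auto
        finally have Fi: "norm (F i (t *\<^sub>R x) - P i (t *\<^sub>R x)) \<le> \<bar>C i\<bar> * norm x ^ m" .
        show "norm (x$i *\<^sub>R (F i (t *\<^sub>R x) - P i (t *\<^sub>R x))) \<le> \<bar>C i\<bar> * norm x ^ Suc m"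
          using mult_mono[OF component_le_norm_cart[of x i] Fi] by (simp add: mult_ac)
      qed
    qed
    then show ?thesis by (simp add: Q0)
  qed
  with Q \<rho>(1) show ?case by blast
qed

text \<open>A remainder estimate uniform in the base point. The mean value inequality is applied to
  the directional derivative, using the bounded second derivative near 0, and then to f minus its
  linear part.\<close>

lemma second_order_remainder:
  fixes f :: "'a::euclidean_space \<Rightarrow> 'b::real_normed_vector"
  assumes f: "Ck_on 2 U f" and U: "open U" "0 \<in> U" and b: "b \<in> Basis"
  shows "\<exists>K r. 0 < r \<and> (\<forall>x t. norm x < r \<longrightarrow> \<bar>t\<bar> < r \<longrightarrow>
    norm (f (x + t *\<^sub>R b) - f x - t *\<^sub>R frechet_derivative f (at x) b) \<le> K * t ^ 2)"
proof -
  define F where "F x = frechet_derivative f (at x) b" for x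
  define H where "H x = frechet_derivative F (at x) b" for x
  have f': "Ck_on (Suc 1) U f" using f by (simp add: numeral_2_eq_2)
  have F: "Ck_on (Suc 0) U F" using f' b by (simp add: F_def[abs_def])
  then have "continuous_on U H" using b by (simp add: H_def[abs_def])
  then have "isCont H 0" using U by (simp add: continuous_on_eq_continuous_at)
  then obtain r1 where r1: "r1 > 0" "\<And>x. norm x < r1 \<Longrightarrow> norm (H x - H 0) < 1"
    using isCont_norm_bound by blast
  from U obtain r0 where r0: "r0 > 0" "ball 0 r0 \<subseteq> U" by (meson openE)
  define r where "r = min r0 r1 / 2"
  define K where "K = norm (H 0) + 1"
  have H: "norm (H x) \<le> K" if "norm x < r1" for x
    using r1(2)[OF that] norm_triangle_sub[of "H x" "H 0"] by (simp add: K_def)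
  have small: "x + s *\<^sub>R b \<in> U \<and> norm (x + s *\<^sub>R b) < r1" if "norm x < r" "\<bar>s\<bar> < r" for x s
  proof -
    have "norm (x + s *\<^sub>R b) \<le> norm x + \<bar>s\<bar>"
      using norm_triangle_ineq[of x "s *\<^sub>R b"] b by simp
    then have "norm (x + s *\<^sub>R b) < min r0 r1" using that by (simp add: r_def)
    then show ?thesis using r0 by auto
  qed
  have "norm (f (x + t *\<^sub>R b) - f x - t *\<^sub>R F x) \<le> K * t ^ 2" if x: "norm x < r" and t: "\<bar>t\<bar> < r" for x t
  proof -
    have seg: "\<bar>s\<bar> \<le> \<bar>t\<bar>" if "s \<in> closed_segment 0 t" for s
      using that by (auto simp: closed_segment_eq_real_ivl split: if_splits)
    have F_bd: "norm (F (x + s *\<^sub>R b) - F x) \<le> K * \<bar>t\<bar>" if s: "s \<in> closed_segment 0 t" for s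
    proof -
      have "norm (F (x + s *\<^sub>R b) - F (x + 0 *\<^sub>R b)) \<le> K * \<bar>s - 0\<bar>"
      proof (rule norm_diff_le_of_deriv_le[where g = "\<lambda>s. F (x + s *\<^sub>R b)"])
        fix u assume "u \<in> closed_segment 0 s"
        then have "\<bar>u\<bar> < r" using seg[OF s] t by (auto simp: closed_segment_eq_real_ivl split: if_splits)
        note sm = small[OF x this]
        show "((\<lambda>s. F (x + s *\<^sub>R b)) has_vector_derivative H (x + u *\<^sub>R b)) (at u)"
          unfolding H_def using sm by (intro has_vector_derivative_line Ck_on_frechet[OF F U(1)]) simp
        show "norm (H (x + u *\<^sub>R b)) \<le> K" using H sm by blast
      qed
      also have "\<dots> \<le> K * \<bar>t\<bar>" using seg[OF s] by (simp add: K_def mult_left_mono)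
      finally show ?thesis by simp
    qed
    have "norm ((f (x + t *\<^sub>R b) - t *\<^sub>R F x) - (f (x + 0 *\<^sub>R b) - 0 *\<^sub>R F x)) \<le> (K * \<bar>t\<bar>) * \<bar>t - 0\<bar>"
    proof (rule norm_diff_le_of_deriv_le[where g = "\<lambda>s. f (x + s *\<^sub>R b) - s *\<^sub>R F x"])
      fix s assume s: "s \<in> closed_segment 0 t"
      have "\<bar>s\<bar> < r" using seg[OF s] t by simp
      note sm = small[OF x this]
      have "((\<lambda>s. f (x + s *\<^sub>R b)) has_vector_derivative F (x + s *\<^sub>R b)) (at s)"
        unfolding F_def using sm by (intro has_vector_derivative_line Ck_on_frechet[OF f' U(1)]) simp
      moreover have "((\<lambda>s. s *\<^sub>R F x) has_vector_derivative F x) (at s)"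
        by (auto intro!: derivative_eq_intros simp: has_vector_derivative_def)
      ultimately show "((\<lambda>s. f (x + s *\<^sub>R b) - s *\<^sub>R F x) has_vector_derivative F (x + s *\<^sub>R b) - F x) (at s)"
        by (rule has_vector_derivative_diff)
    qed (rule F_bd)
    then show ?thesis by (simp add: algebra_simps power2_eq_square abs_mult_self_eq)
  qed
  moreover have "r > 0" using r0 r1 by (simp add: r_def)
  ultimately show ?thesis unfolding F_def by blast
qed

text \<open>Interpolation between \<open>e = O(|x|\<^sup>2\<^sup>D)\<close> and a bounded second derivative: take an increment of
  length \<open>|x|\<^sup>D\<close>.\<close>

lemma derivative_bound_interpolation:
  fixes e :: "'a::real_normed_vector \<Rightarrow> 'b::real_normed_vector"
  assumes D: "1 \<le> D" and r: "0 < r" and b: "norm b = 1"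
    and rem: "\<And>x t. norm x < r \<Longrightarrow> \<bar>t\<bar> < r \<Longrightarrow> norm (e (x + t *\<^sub>R b) - e x - t *\<^sub>R e1 x) \<le> K * t ^ 2"
    and e: "\<And>x. norm x < r \<Longrightarrow> norm (e x) \<le> C * norm x ^ (2 * D)"
  shows "\<exists>C' r'. 0 < r' \<and> (\<forall>x. norm x < r' \<longrightarrow> norm (e1 x) \<le> C' * norm x ^ D)"
proof -
  \<comment> \<open>The summands come from the remainder term, from e at the displaced point, whose
    norm is at most 2 s, and from e at x.\<close>
  define M where "M = \<bar>K\<bar> + \<bar>C\<bar> * 2 ^ (2 * D) + \<bar>C\<bar>"
  define \<rho> where "\<rho> = min (r / 2) 1"
  have \<rho>: "0 < \<rho>" "\<rho> \<le> 1" "2 * \<rho> \<le> r" using r by (auto simp: \<rho>_def)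
  \<comment> \<open>The radius s only bounds the norm of x from above, so the estimate at x = 0
    follows on letting s tend to 0.\<close>
  have key: "norm (e1 x) \<le> M * s ^ D" if s: "norm x \<le> s" "0 < s" "s < \<rho>" for x s
  proof -
    define t where "t = s ^ D"
    have t: "0 < t" "t \<le> s" "t ^ 2 = s ^ (2 * D)"
      using s \<rho> D power_decreasing[of 1 D s] by (auto simp: t_def power_mult[symmetric] mult.commute)
    have "norm (x + t *\<^sub>R b) \<le> norm x + t"
      using norm_triangle_ineq[of x "t *\<^sub>R b"] b t by simp
    then have x': "norm (x + t *\<^sub>R b) \<le> 2 * s" using s t by simp
    have Cb: "norm (e y) \<le> \<bar>C\<bar> * u ^ (2 * D)" if "norm y \<le> u" "u < r" for y u
    proof -
      have "norm (e y) \<le> C * norm y ^ (2 * D)" using e that by simp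
      also have "\<dots> \<le> \<bar>C\<bar> * u ^ (2 * D)"
        using that by (intro mult_mono power_mono) auto
      finally show ?thesis .
    qed
    have e1: "norm (e (x + t *\<^sub>R b)) \<le> \<bar>C\<bar> * (2 * s) ^ (2 * D)"
      using x' s \<rho> by (intro Cb) auto
    have e2: "norm (e x) \<le> \<bar>C\<bar> * s ^ (2 * D)"
      using s \<rho> by (intro Cb) auto
    have e3: "norm (e (x + t *\<^sub>R b) - e x - t *\<^sub>R e1 x) \<le> \<bar>K\<bar> * s ^ (2 * D)"
    proof -
      have "norm (e (x + t *\<^sub>R b) - e x - t *\<^sub>R e1 x) \<le> K * t ^ 2"
        using s t \<rho> by (intro rem) auto
      also have "\<dots> \<le> \<bar>K\<bar> * t ^ 2" by (intro mult_right_mono) auto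
      finally show ?thesis using t(3) by simp
    qed
    have "t * norm (e1 x) = norm (e (x + t *\<^sub>R b) - e x - (e (x + t *\<^sub>R b) - e x - t *\<^sub>R e1 x))"
      using t by simp
    also have "\<dots> \<le> norm (e (x + t *\<^sub>R b)) + norm (e x) + norm (e (x + t *\<^sub>R b) - e x - t *\<^sub>R e1 x)"
      by (rule order_trans[OF norm_triangle_ineq4]) (simp add: norm_triangle_ineq4)
    also have "\<dots> \<le> M * s ^ (2 * D)"
      using e1 e2 e3 by (simp add: M_def algebra_simps power_mult_distrib)
    also have "\<dots> = t * (M * s ^ D)" by (simp add: t_def mult_2 power_add)
    finally show ?thesis using t by simp
  qed
  have "norm (e1 x) \<le> M * norm x ^ D" if x: "norm x < \<rho>" for x
  proof (cases "x = 0")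
    case False
    then show ?thesis using key[of x "norm x"] x by simp
  next
    case True
    have "((\<lambda>s. M * s ^ D) \<longlongrightarrow> M * 0 ^ D) (at_right 0)" by (intro tendsto_intros)
    moreover have "\<forall>\<^sub>F s in at_right 0. norm (e1 x) \<le> M * s ^ D"
      unfolding eventually_at_right_field using key[of x] True \<rho> by (intro exI[of _ \<rho>]) auto
    ultimately have "norm (e1 x) \<le> M * 0 ^ D"
      by (intro tendsto_lowerbound) auto
    then show ?thesis using True by simp
  qed
  then show ?thesis using \<rho> by blast
qed

section \<open>Reduction to normal form\<close>

lemma Nmat_nth:
  "(Nmat *v x) $ 1 = x $ 2" "(Nmat *v x) $ 2 = x $ 3" "(Nmat *v x) $ 3 = 0"
  by (simp_all add: Nmat_def matrix_vector_mult_def sum_3)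

lemma e3_nth: "e3 $ 1 = 0" "e3 $ 2 = 0" "e3 $ 3 = 1"
  by (simp_all add: e3_def)

definition nform :: "(real^3 \<Rightarrow> real) \<Rightarrow> real^3 \<Rightarrow> real^3" where
  "nform p x = Nmat *v x + p x *\<^sub>R e3"

lemma nform_nth: "nform p x $ 1 = x $ 2" "nform p x $ 2 = x $ 3" "nform p x $ 3 = p x"
  by (simp_all add: nform_def Nmat_nth e3_nth)

definition pure12 :: "(real^3 \<Rightarrow> real) \<Rightarrow> bool" where
  "pure12 = mspan (\<lambda>i j l. 2 \<le> i + j \<and> l = 0)"

lemma pure12_pord: "pure12 p \<Longrightarrow> pord 2 p"
  unfolding pure12_def by (erule mspan_mono) (simp add: deg_ge_def)

lemma pure12_pd3:
  assumes "pure12 p"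
  shows "pd 3 p = (\<lambda>_. 0)"
proof -
  \<comment> \<open>With no positive exponent of \<open>x$3\<close>, the derivative has no
    admissible monomials; the span of the empty set is zero.\<close>
  have "mspan (\<lambda>_ _ _. False) (pd 3 p)"
    using assms unfolding pure12_def by (rule mspan_pd3) simp
  then show ?thesis by induction auto
qed

lemma pordv_nform: "pure12 p \<Longrightarrow> pordv 1 (nform p)"
  using pord_mono[OF pure12_pord, of p 1] pord_coord by (simp add: forall_3 nform_nth)

lemma vdiv_nform: "pure12 p \<Longrightarrow> vdiv (nform p) x = 0"
  by (simp add: vdiv_def nform_nth pd_coord pure12_pd3)

lemma vdiv_add:
  assumes "pordv m f" "pordv n g"
  shows "vdiv (\<lambda>x. f x + g x) x = vdiv f x + vdiv g x"
proof -
  have "pd i (\<lambda>x. f x $ i + g x $ i) = (\<lambda>x. pd i (\<lambda>x. f x $ i) x + pd i (\<lambda>x. g x $ i) x)" for i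
    using assms by (intro pd_add) auto
  then show ?thesis by (simp add: vdiv_def)
qed

lemma pord_vdiv:
  assumes "pordv (Suc m) g"
  shows "pord m (vdiv g)"
  unfolding vdiv_def[abs_def]
  using assms pord_pd[of "Suc m"] by (intro mspan_add) auto

lemma homog_vdiv:
  assumes "\<And>i. homog (Suc m) (\<lambda>x. g x $ i)"
  shows "homog m (vdiv g)"
  unfolding vdiv_def[abs_def]
  by (intro mspan_add homog_pd assms)

text \<open>The invariant of the iteration over \<open>k\<close>. Divergence vanishes only to order
  \<open>D\<close>, since the field is a polynomial approximation of the divergence-free
  one.\<close>

definition in_nform :: "nat \<Rightarrow> nat \<Rightarrow> (real^3 \<Rightarrow> real^3) \<Rightarrow> (real^3 \<Rightarrow> real) \<Rightarrow> bool" where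
  "in_nform D k w p \<longleftrightarrow> pordv 0 w \<and> pord D (vdiv w) \<and> pure12 p \<and> pordv k (\<lambda>x. w x - nform p x)"

text \<open>The divergence of the leading part R is homogeneous of degree \<open>k\<close>. It also
  equals div w - div g, which has order k + 1 because \<open>Suc k \<le> D\<close>; hence it is
  zero.\<close>

lemma leading_part_div_free:
  assumes nf: "in_nform D (Suc k) w p" and "Suc k \<le> D"
  obtains R g where "\<And>i. homog (Suc k) (\<lambda>x. R x $ i)" "\<And>x. vdiv R x = 0"
    "pordv (Suc (Suc k)) g" "\<And>x. w x = nform p x + (R x + g x)"
proof -
  have p: "pure12 p" and w: "pord D (vdiv w)" and d: "\<And>i. pord (Suc k) (\<lambda>x. (w x - nform p x) $ i)"
    using nf by (auto simp: in_nform_def)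
  have "\<forall>i. \<exists>h g. homog (Suc k) h \<and> pord (Suc (Suc k)) g \<and>
      (\<lambda>x. (w x - nform p x) $ i) = (\<lambda>x. h x + g x)"
    using pord_decomp[OF d] by metis
  then obtain h g where hg: "\<And>i. homog (Suc k) (h i)" "\<And>i. pord (Suc (Suc k)) (g i)"
    "\<And>i. (\<lambda>x. (w x - nform p x) $ i) = (\<lambda>x. h i x + g i x)"
    by metis
  define R :: "real^3 \<Rightarrow> real^3" where "R x = (\<chi> i. h i x)" for x
  define G :: "real^3 \<Rightarrow> real^3" where "G x = (\<chi> i. g i x)" for x
  have R: "\<And>i. homog (Suc k) (\<lambda>x. R x $ i)" and G: "pordv (Suc (Suc k)) G"
    using hg by (simp_all add: R_def G_def)
  have eq: "w x = nform p x + (R x + G x)" for x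
  proof -
    have "(w x - nform p x) $ i = R x $ i + G x $ i" for i
      using fun_cong[OF hg(3)[of i], of x] by (simp add: R_def G_def)
    then show ?thesis by (simp add: vec_eq_iff algebra_simps)
  qed
  have R0: "pordv 0 R" using R mspan_pord0 by blast
  have RG: "pordv 0 (\<lambda>x. R x + G x)"
    using R0 G mspan_pord0 by (auto intro!: mspan_add)
  have "vdiv w x = vdiv (nform p) x + (vdiv R x + vdiv G x)" for x
    unfolding eq[abs_def] vdiv_add[OF pordv_nform[OF p] RG] vdiv_add[OF R0 G] ..
  then have "vdiv R = (\<lambda>x. vdiv w x - vdiv G x)"
    by (simp add: fun_eq_iff vdiv_nform[OF p])
  moreover have "pord (Suc k) (\<lambda>x. vdiv w x - vdiv G x)"
    using pord_mono[OF w assms(2)] pord_vdiv[OF G] by (rule mspan_diff)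
  ultimately have "vdiv R = (\<lambda>_. 0)"
    using homog_vdiv[OF R] by (intro homog_pord_eq_0[of k]) auto
  then show thesis using that[OF R _ G eq] by simp
qed

lemma in_nform_step:
  assumes nf: "in_nform D k w p" and k: "2 \<le> k" "k \<le> D"
  shows "\<exists>\<psi> \<phi> w' p'. shearcomp \<psi> \<phi> \<and> in_nform D (Suc k) w' p' \<and>
    (\<forall>x. w' (\<psi> x) = frechet_derivative \<psi> (at x) (w x))"
proof -
  obtain k' where k': "k = Suc k'" using k by (cases k) auto
  have p: "pure12 p" and w0: "pordv 0 w" and wd: "pord D (vdiv w)"
    using nf by (auto simp: in_nform_def)
  obtain R g where R: "\<And>i. homog k (\<lambda>x. R x $ i)" "\<And>x. vdiv R x = 0"
    and g: "pordv (Suc k) g" and w: "\<And>x. w x = nform p x + (R x + g x)"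
    using leading_part_div_free[of D k' w p] nf k unfolding k' by metis
  obtain h q where h: "\<And>i. homog k (\<lambda>x. h x $ i)" "\<And>x. vdiv h x = 0"
    and q: "mspan (\<lambda>i j l. i + j = k \<and> l = 0) q"
    and hom: "\<And>x. R x $ 1 + lieN (\<lambda>x. h x $ 1) x - h x $ 2 = 0"
      "\<And>x. R x $ 2 + lieN (\<lambda>x. h x $ 2) x - h x $ 3 = 0"
      "\<And>x. R x $ 3 + lieN (\<lambda>x. h x $ 3) x = q x"
    by (rule homological_equation[OF R(1)[unfolded k'] R(2), folded k']) (rule that)
  obtain \<psi> \<phi> where \<psi>: "shearcomp \<psi> \<phi>" and \<psi>h: "\<And>i. pord (Suc k) (\<lambda>x. \<psi> x $ i - x $ i - h x $ i)"
    using shearsum_realize[OF homog_shearsum[OF h] k(1)] by blast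
  obtain w' where w': "pordv 0 w'" "\<And>x. w' (\<psi> x) = frechet_derivative \<psi> (at x) (w x)"
    "\<And>x. vdiv w' (\<psi> x) = vdiv w x"
    using shearcomp_push[OF \<psi> w0] by blast
  define \<rho> where "\<rho> i x = \<psi> x $ i - x $ i - h x $ i" for i x
  define p' where "p' x = p x + q x" for x
  have q2: "pure12 q" and qk: "pord k q"
    using q k unfolding pure12_def by (auto elim!: mspan_mono simp: deg_ge_def)
  have p': "pure12 p'"
    using p q2 unfolding pure12_def p'_def[abs_def] by (rule mspan_add)
  have hk: "pord k (\<lambda>x. h x $ i)" for i using homog_pord[OF h(1)] by simp
  have \<rho>: "pord (Suc k) (\<rho> i)" for i using \<psi>h by (simp add: \<rho>_def[abs_def])
  have id_k: "pord k (\<lambda>x. \<psi> x $ i - x $ i)" for i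
    using mspan_add[OF pord_mono[OF \<rho>, of k i] hk[of i]] by (simp add: \<rho>_def)
  have id_2: "pord 2 (\<lambda>x. \<psi> x $ i - x $ i)" for i
    using pord_mono[OF id_k k(1)] .
  have wN: "pord 2 (\<lambda>x. (w x - Nmat *v x) $ i)" for i
  proof -
    have "pord 2 (\<lambda>x. p x * e3 $ i)"
      using mspan_scale[OF pure12_pord[OF p], of "e3 $ i"] by (simp add: mult.commute)
    moreover have "pord 2 (\<lambda>x. R x $ i)" "pord 2 (\<lambda>x. g x $ i)"
      using homog_pord[OF R(1) k(1)] g pord_mono[of "Suc k" _ 2] k(1) by auto
    ultimately show ?thesis by (simp add: w nform_def mspan_add)
  qed
  have Nx: "pord 1 (\<lambda>x. (Nmat *v x) $ i)" for i
    using exhaust_3[of i] pord_coord mspan_zero by (auto simp: Nmat_nth)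
  have w1: "pord 1 (\<lambda>x. w x $ i)" for i
    using mspan_add[OF pord_mono[OF wN, of 1 i] Nx[of i]] by simp
  \<comment> \<open>With \<psi> = x + h + \<rho>, the transported field is w + Dh N x + T. In T, Dh
    has order k - 1 against w - N x of order 2, and D\<rho> has order k against w of order 1, so T
    has order k + 1.\<close>
  define T where "T i x = (\<Sum>j\<in>UNIV. pd j (\<lambda>x. h x $ i) x * (w x - Nmat *v x) $ j)
    + (\<Sum>j\<in>UNIV. pd j (\<rho> i) x * w x $ j)" for i x
  have T: "pord (Suc k) (T i)" for i
  proof -
    have "pord (Suc k) (\<lambda>x. pd j (\<lambda>x. h x $ i) x * (w x - Nmat *v x) $ j)" for j
      using k by (intro pord_mult_mono[OF pord_pd[OF hk] wN]) simp
    moreover have "pord (Suc k) (\<lambda>x. pd j (\<rho> i) x * w x $ j)" for j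
      by (intro pord_mult_mono[OF pord_pd[OF \<rho>] w1]) simp
    ultimately show ?thesis unfolding T_def[abs_def] by (intro mspan_add mspan_sum)
  qed
  have push: "w' (\<psi> x) $ i = w x $ i + lieN (\<lambda>x. h x $ i) x + T i x" for x i
  proof -
    have \<psi>_i: "(\<lambda>x. \<psi> x $ i) = (\<lambda>x. x $ i + (h x $ i + \<rho> i x))" by (simp add: \<rho>_def)
    have "pd j (\<lambda>x. \<psi> x $ i) = (\<lambda>x. (if j = i then 1 else 0) + (pd j (\<lambda>x. h x $ i) x + pd j (\<rho> i) x))" for j
      unfolding \<psi>_i pd_add[OF pord_coord mspan_add[OF pord_mono[OF hk le0] pord_mono[OF \<rho> le0]]]
        pd_add[OF hk \<rho>] pd_coord ..
    moreover have "(\<Sum>j\<in>UNIV. pd j (\<lambda>x. h x $ i) x * (w x - Nmat *v x) $ j) + lieN (\<lambda>x. h x $ i) x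
        = (\<Sum>j\<in>UNIV. pd j (\<lambda>x. h x $ i) x * w x $ j)"
      by (simp add: sum_3 lieN_def Nmat_nth algebra_simps)
    moreover have "(\<Sum>j\<in>UNIV. (if j = i then 1 else 0) * w x $ j) = w x $ i"
      using exhaust_3[of i] by (auto simp: sum_3)
    ultimately show ?thesis
      unfolding w'(2) pordv_frechet[OF shearcomp_pordv(3)[OF \<psi>]] T_def
      by (simp add: distrib_right sum.distrib del: vector_minus_component)
  qed
  have "pord (Suc k) (\<lambda>x. (w' (\<psi> x) - nform p' (\<psi> x)) $ i)" for i
  proof -
    \<comment> \<open>For p, order 2 meets a displacement of order k; for q, order k meets one of
      order 2. Either way the difference has order k + 1.\<close>
    have pd: "pord (Suc k) (\<lambda>x. p (\<psi> x) - p x)"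
      using k by (intro pord_compose_diff[OF pure12_pord[OF p] id_k]) auto
    have qd: "pord (Suc k) (\<lambda>x. q (\<psi> x) - q x)"
      by (intro pord_compose_diff[OF qk id_2]) auto
    have gi: "pord (Suc k) (\<lambda>x. g x $ i)" for i using g by simp
    have \<psi>_eq: "\<psi> x $ i = x $ i + h x $ i + \<rho> i x" for x i by (simp add: \<rho>_def)
    \<comment> \<open>In each component the homological equation cancels the terms in R and h,
      leaving only terms of order k + 1.\<close>
    have "(w' (\<psi> x) - nform p' (\<psi> x)) $ 1 = g x $ 1 + T 1 x - \<rho> 2 x" for x
      using hom(1)[of x] by (simp add: push w nform_nth \<psi>_eq)
    moreover have "(w' (\<psi> x) - nform p' (\<psi> x)) $ 2 = g x $ 2 + T 2 x - \<rho> 3 x" for x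
      using hom(2)[of x] by (simp add: push w nform_nth \<psi>_eq)
    moreover have "(w' (\<psi> x) - nform p' (\<psi> x)) $ 3 =
        g x $ 3 + T 3 x - (p (\<psi> x) - p x) - (q (\<psi> x) - q x)" for x
      using hom(3)[of x] by (simp add: push w nform_nth p'_def)
    moreover have "pord (Suc k) (\<lambda>x. g x $ 1 + T 1 x - \<rho> 2 x)" "pord (Suc k) (\<lambda>x. g x $ 2 + T 2 x - \<rho> 3 x)"
      "pord (Suc k) (\<lambda>x. g x $ 3 + T 3 x - (p (\<psi> x) - p x) - (q (\<psi> x) - q x))"
      by (intro mspan_add mspan_diff gi T \<rho> pd qd)+
    ultimately show ?thesis using exhaust_3[of i] by auto
  qed
  \<comment> \<open>The estimate was obtained in the old coordinate x; substituting \<phi>, which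
    fixes the origin, moves it to the new one without loss of order.\<close>
  then have "pordv (Suc k) (\<lambda>x. w' x - nform p' x)"
    using pord_compose[of "Suc k" "\<lambda>x. (w' (\<psi> x) - nform p' (\<psi> x)) $ _" \<phi>] shearcomp_pordv(2)[OF \<psi>]
    by (simp add: shearcomp_inverse(2)[OF \<psi>])
  moreover have "pord D (vdiv w')"
  proof -
    have "vdiv w' = (\<lambda>x. vdiv w (\<phi> x))"
      using w'(3) shearcomp_inverse(2)[OF \<psi>] by metis
    then show ?thesis using pord_compose[OF wd] shearcomp_pordv(2)[OF \<psi>] by simp
  qed
  ultimately have "in_nform D (Suc k) w' p'"
    using w'(1) p' by (simp add: in_nform_def)
  with \<psi> w'(2) show ?thesis by blast
qed

text \<open>A step from order k needs k \<le> D, so the order can reach D + 1. The chain rule merges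
  the successive transports into one.\<close>

lemma in_nform_reduction:
  assumes nf: "in_nform D 2 w p" and "2 + n \<le> Suc D"
  shows "\<exists>\<psi> \<phi> w' p'. shearcomp \<psi> \<phi> \<and> in_nform D (2 + n) w' p' \<and>
    (\<forall>x. w' (\<psi> x) = frechet_derivative \<psi> (at x) (w x))"
  using assms(2)
proof (induction n)
  case 0
  show ?case
    using nf by (intro exI[of _ "\<lambda>x. x"] exI[of _ w] exI[of _ p]) (simp add: shearcomp_id)
next
  case (Suc n)
  then obtain \<psi>1 \<phi>1 w1 p1 where 1: "shearcomp \<psi>1 \<phi>1" "in_nform D (2 + n) w1 p1"
    "\<And>x. w1 (\<psi>1 x) = frechet_derivative \<psi>1 (at x) (w x)" by auto
  obtain \<psi>2 \<phi>2 w2 p2 where 2: "shearcomp \<psi>2 \<phi>2" "in_nform D (Suc (2 + n)) w2 p2"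
    "\<And>x. w2 (\<psi>2 x) = frechet_derivative \<psi>2 (at x) (w1 x)"
    using in_nform_step[OF 1(2)] Suc(2) by auto
  have "frechet_derivative (\<lambda>x. \<psi>2 (\<psi>1 x)) (at x) =
      (\<lambda>h. frechet_derivative \<psi>2 (at (\<psi>1 x)) (frechet_derivative \<psi>1 (at x) h))" for x
    using has_derivative_compose[OF pordv_frechet_works[OF shearcomp_pordv(3)[OF 1(1)]]
        pordv_frechet_works[OF shearcomp_pordv(3)[OF 2(1)]]]
    by (rule frechet_derivative_at[symmetric])
  then have "\<forall>x. w2 (\<psi>2 (\<psi>1 x)) = frechet_derivative (\<lambda>x. \<psi>2 (\<psi>1 x)) (at x) (w x)"
    by (simp add: 1 2)
  moreover have "in_nform D (2 + Suc n) w2 p2" using 2(2) by simp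
  ultimately show ?case
    using shearcomp_compose[OF 2(1) 1(1)] by blast
qed

lemma pure12_poly2:
  assumes "pure12 p"
  obtains K c where "\<And>i j. i + j < 2 \<Longrightarrow> c i j = 0" "\<And>x. p x = poly2 K c (x$1) (x$2)"
proof -
  \<comment> \<open>The representation is claimed for every cutoff L \<ge> K, so that a new monomial
    may enlarge the cutoff.\<close>
  have "\<exists>K c. (\<forall>i j. i + j < 2 \<longrightarrow> c i j = 0) \<and> (\<forall>L\<ge>K. \<forall>x. p x = poly2 L c (x$1) (x$2))"
    using assms unfolding pure12_def
  proof induction
    case mspan_zero
    then show ?case by (intro exI[of _ 0] exI[of _ "\<lambda>_ _. 0"]) (simp add: poly2_def)
  next
    case (mspan_step i j l f d)
    then obtain K c where c: "\<And>i j. i + j < 2 \<Longrightarrow> c i j = 0"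
      "\<And>L x. L \<ge> K \<Longrightarrow> f x = poly2 L c (x$1) (x$2)" by metis
    define c' where "c' i' j' = c i' j' + (if i' = i then if j' = j then d else 0 else 0)" for i' j'
    have "d * monom3 i j l x + f x = poly2 L c' (x$1) (x$2)" if L: "L \<ge> max K (max i j)" for L x
    proof -
      have "poly2 L c' (x$1) (x$2) = poly2 L c (x$1) (x$2) +
          (\<Sum>i'\<le>L. \<Sum>j'\<le>L. if i' = i then if j' = j then d * x$1 ^ i * x$2 ^ j else 0 else 0)"
        unfolding poly2_def sum.distrib[symmetric]
        by (intro sum.cong refl) (simp add: c'_def algebra_simps)
      also have "(\<Sum>i'\<le>L. \<Sum>j'\<le>L. if i' = i then if j' = j then d * x$1 ^ i * x$2 ^ j else 0 else 0)
          = (\<Sum>i'\<le>L. if i' = i then d * x$1 ^ i * x$2 ^ j else 0)"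
        using L by (intro sum.cong) auto
      also have "\<dots> = d * monom3 i j l x"
        using L mspan_step(1) by (simp add: monom3_def)
      finally show ?thesis using c(2)[of L x] L by simp
    qed
    moreover have "c' i' j' = 0" if "i' + j' < 2" for i' j'
      using that c(1) mspan_step(1) by (auto simp: c'_def)
    ultimately show ?case by blast
  qed
  then show thesis using that by blast
qed

section \<open>Estimates for the Taylor approximation and the transformed field\<close>

lemma pordv_bound:
  assumes "pordv m w"
  obtains C where "0 \<le> C" "\<And>x. norm x \<le> 1 \<Longrightarrow> norm (w x) \<le> C * norm x ^ m"
proof -
  have "\<forall>i. \<exists>C\<ge>0. \<forall>x. norm x \<le> 1 \<longrightarrow> \<bar>w x $ i\<bar> \<le> C * norm x ^ m"
    using pord_bound assms by blast
  then obtain C where C: "\<And>i. 0 \<le> C i" "\<And>i x. norm x \<le> 1 \<Longrightarrow> \<bar>w x $ i\<bar> \<le> C i * norm x ^ m"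
    by metis
  have "norm (w x) \<le> (\<Sum>i\<in>UNIV. C i) * norm x ^ m" if "norm x \<le> 1" for x
    unfolding sum_distrib_right
    using norm_le_l1_cart[of "w x"] C(2)[OF that] by (meson order_trans sum_mono)
  then show thesis using that C(1) by (meson sum_nonneg)
qed

lemma pordv_frechet_bound:
  assumes "pordv 0 w"
  obtains C where "0 \<le> C" "\<And>x h. norm x \<le> 1 \<Longrightarrow> norm (frechet_derivative w (at x) h) \<le> C * norm h"
proof -
  have "pord 0 (pd j (\<lambda>x. w x $ i))" for i j using assms pord0_pd by blast
  from pord_bound[OF this]
  have "\<forall>i j. \<exists>C\<ge>0. \<forall>x. norm x \<le> 1 \<longrightarrow> \<bar>pd j (\<lambda>x. w x $ i) x\<bar> \<le> C" by simp
  then obtain C where C: "\<And>i j. 0 \<le> C i j"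
    "\<And>i j x. norm x \<le> 1 \<Longrightarrow> \<bar>pd j (\<lambda>x. w x $ i) x\<bar> \<le> C i j"
    by metis
  have "norm (frechet_derivative w (at x) h) \<le> (\<Sum>i\<in>UNIV. \<Sum>j\<in>UNIV. C i j) * norm h"
    if "norm x \<le> 1" for x h
  proof -
    have "\<bar>pd j (\<lambda>x. w x $ i) x * h $ j\<bar> \<le> C i j * norm h" for i j
      unfolding abs_mult using C that by (intro mult_mono component_le_norm_cart) auto
    then have "\<bar>frechet_derivative w (at x) h $ i\<bar> \<le> (\<Sum>j\<in>UNIV. C i j) * norm h" for i
      unfolding pordv_frechet[OF assms] sum_distrib_right
      by (intro order_trans[OF sum_abs] sum_mono)
    then show ?thesis
      unfolding sum_distrib_right[of _ _ "norm h"]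
      by (intro order_trans[OF norm_le_l1_cart] sum_mono)
  qed
  then show thesis using that C(1) by (meson sum_nonneg)
qed

text \<open>Closeness of values does not by itself give closeness of derivatives. Second-order
  remainders for both v and P supply the bounded second difference that the interpolation lemma
  needs, at the price of half the exponent.\<close>

lemma frechet_diff_bound:
  fixes v :: "real^3 \<Rightarrow> real^3"
  assumes U: "open U" "0 \<in> U" and v: "smooth_on U v" and P: "pordv 0 P" and D: "1 \<le> D"
    and r: "0 < r" and bd: "\<And>x. norm x < r \<Longrightarrow> norm (v x - P x) \<le> C * norm x ^ (2 * D)"
  shows "\<exists>C' r'. 0 < r' \<and> (\<forall>x. norm x < r' \<longrightarrow>
    norm (frechet_derivative v (at x) (axis i 1) - frechet_derivative P (at x) (axis i 1)) \<le> C' * norm x ^ D)"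
proof -
  have b: "axis i 1 \<in> (Basis :: (real^3) set)" by (simp add: axis_in_Basis_iff)
  have "Ck_on 2 U v" using v unfolding smooth_on_def by blast
  from second_order_remainder[OF this U b] obtain K1 r1 where 1: "0 < r1"
    "\<And>x t. norm x < r1 \<Longrightarrow> \<bar>t\<bar> < r1 \<Longrightarrow>
      norm (v (x + t *\<^sub>R axis i 1) - v x - t *\<^sub>R frechet_derivative v (at x) (axis i 1)) \<le> K1 * t ^ 2"
    by blast
  from second_order_remainder[OF pordv_Ck_on[OF P] U b] obtain K2 r2 where 2: "0 < r2"
    "\<And>x t. norm x < r2 \<Longrightarrow> \<bar>t\<bar> < r2 \<Longrightarrow>
      norm (P (x + t *\<^sub>R axis i 1) - P x - t *\<^sub>R frechet_derivative P (at x) (axis i 1)) \<le> K2 * t ^ 2"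
    by blast
  define s where "s = min r (min r1 r2)"
  show ?thesis
  proof (rule derivative_bound_interpolation[OF D])
    show "0 < s" using r 1 2 by (simp add: s_def)
    show "norm (axis i 1 :: real^3) = 1" using b by (rule norm_Basis)
    show "norm (v x - P x) \<le> C * norm x ^ (2 * D)" if "norm x < s" for x
      using bd that by (simp add: s_def)
    fix x :: "real^3" and t :: real assume xt: "norm x < s" "\<bar>t\<bar> < s"
    have "norm (v (x + t *\<^sub>R axis i 1) - P (x + t *\<^sub>R axis i 1) - (v x - P x) -
        t *\<^sub>R (frechet_derivative v (at x) (axis i 1) - frechet_derivative P (at x) (axis i 1)))
      = norm ((v (x + t *\<^sub>R axis i 1) - v x - t *\<^sub>R frechet_derivative v (at x) (axis i 1))
        - (P (x + t *\<^sub>R axis i 1) - P x - t *\<^sub>R frechet_derivative P (at x) (axis i 1)))"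
      by (simp add: algebra_simps)
    also have "\<dots> \<le> K1 * t ^ 2 + K2 * t ^ 2"
      using 1(2)[of x t] 2(2)[of x t] xt
      by (intro order_trans[OF norm_triangle_ineq4 add_mono]) (auto simp: s_def)
    finally show "norm (v (x + t *\<^sub>R axis i 1) - P (x + t *\<^sub>R axis i 1) - (v x - P x) -
        t *\<^sub>R (frechet_derivative v (at x) (axis i 1) - frechet_derivative P (at x) (axis i 1)))
      \<le> (K1 + K2) * t ^ 2" by (simp add: algebra_simps)
  qed
qed

lemma divergence_eq:
  fixes v :: "real^3 \<Rightarrow> real^3"
  shows "divergence v x = (\<Sum>i\<in>UNIV. frechet_derivative v (at x) (axis i 1) $ i)"
  by (simp add: divergence_def jacobian_def trace_def matrix_def)

text \<open>The approximation has order 2 D because passing to derivatives halves the exponent,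
  leaving order D for the divergence. The linear part of P is identified by comparing P with v and v
  with N x.\<close>

lemma taylor_in_nform:
  fixes v :: "real^3 \<Rightarrow> real^3"
  assumes U: "open U" "0 \<in> U" and v: "smooth_on U v" and div: "\<forall>x\<in>U. divergence v x = 0"
    and lin: "\<exists>C r. r > 0 \<and> (\<forall>\<xi>. norm \<xi> < r \<longrightarrow> norm (v \<xi> - Nmat *v \<xi>) \<le> C * norm \<xi> ^ 2)"
    and D: "2 \<le> D"
  shows "\<exists>P C r. in_nform D 2 P (\<lambda>_. 0) \<and> 0 < r \<and>
    (\<forall>x. norm x < r \<longrightarrow> norm (v x - P x) \<le> C * norm x ^ (2 * D))"
proof -
  have "Ck_on (2 * D) U v" using v unfolding smooth_on_def by blast
  from taylor_polynomial[OF U this] obtain P C r where P: "pordv 0 P" and r: "0 < r"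
    and bd: "\<And>x. norm x < r \<Longrightarrow> norm (v x - P x) \<le> C * norm x ^ (2 * D)" by blast
  from lin obtain C1 r1 where r1: "0 < r1"
    and bd1: "\<And>x. norm x < r1 \<Longrightarrow> norm (v x - Nmat *v x) \<le> C1 * norm x ^ 2" by blast
  have "pord 2 (\<lambda>x. (P x - Nmat *v x) $ i)" for i
  proof (rule bounded_pord)
    have "pord 0 (\<lambda>x. (Nmat *v x) $ i)"
      using exhaust_3[of i] mspan_pord0[OF pord_coord] mspan_zero by (auto simp: Nmat_nth)
    then show "pord 0 (\<lambda>x. (P x - Nmat *v x) $ i)" using P by (simp add: mspan_diff)
    show "0 < min 1 (min r r1)" using r r1 by simp
    fix x :: "real^3" assume x: "norm x < min 1 (min r r1)"
    have "\<bar>(P x - Nmat *v x) $ i\<bar> \<le> norm (P x - Nmat *v x)" by (rule component_le_norm_cart)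
    also have "\<dots> = norm ((v x - Nmat *v x) - (v x - P x))" by simp
    also have "\<dots> \<le> C1 * norm x ^ 2 + C * norm x ^ (2 * D)"
      using bd[of x] bd1[of x] x by (intro order_trans[OF norm_triangle_ineq4 add_mono]) auto
    also have "C * norm x ^ (2 * D) \<le> \<bar>C\<bar> * norm x ^ 2"
      using x D by (intro mult_mono power_decreasing) auto
    finally show "\<bar>(P x - Nmat *v x) $ i\<bar> \<le> (C1 + \<bar>C\<bar>) * norm x ^ 2" by (simp add: algebra_simps)
  qed
  then have P2: "pordv 2 (\<lambda>x. P x - nform (\<lambda>_. 0) x)" by (simp add: nform_def)
  have "pord D (vdiv P)"
  proof -
    have "\<forall>i. \<exists>C' r'. 0 < r' \<and> (\<forall>x. norm x < r' \<longrightarrow> norm (frechet_derivative v (at x) (axis i 1)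
        - frechet_derivative P (at x) (axis i 1)) \<le> C' * norm x ^ D)"
      using frechet_diff_bound[OF U v P _ r bd] D by auto
    then obtain C' r' where r': "\<And>i::3. 0 < r' i" and C': "\<And>i x. norm x < r' i \<Longrightarrow>
        norm (frechet_derivative v (at x) (axis i 1) - frechet_derivative P (at x) (axis i 1)) \<le> C' i * norm x ^ D"
      by metis
    from U obtain r0 where r0: "r0 > 0" "ball 0 r0 \<subseteq> U" by (meson openE)
    define s where "s = Min (insert r0 (range r'))"
    show ?thesis
    proof (rule bounded_pord)
      show "pord 0 (vdiv P)"
        unfolding vdiv_def[abs_def] using P by (intro mspan_add pord0_pd) auto
      show "0 < s" using r0 r' by (auto simp: s_def)
      fix x :: "real^3" assume "norm x < s"
      then have x: "norm x < r0" "\<And>i. norm x < r' i" by (auto simp: s_def)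
      have "vdiv P x = (\<Sum>i\<in>UNIV. frechet_derivative P (at x) (axis i 1) $ i)"
        by (simp add: vdiv_eqI[OF pordv_frechet_works[OF P]] sum_3)
      moreover have "(\<Sum>i\<in>UNIV. frechet_derivative v (at x) (axis i 1) $ i) = 0"
        using div r0 x by (auto simp: divergence_eq)
      ultimately have "vdiv P x = - (\<Sum>i\<in>UNIV. (frechet_derivative v (at x) (axis i 1)
          - frechet_derivative P (at x) (axis i 1)) $ i)"
        by (simp add: sum_subtractf)
      also have "\<bar>\<dots>\<bar> \<le> (\<Sum>i\<in>UNIV. C' i * norm x ^ D)"
        unfolding abs_minus_cancel
        by (intro order_trans[OF sum_abs] sum_mono order_trans[OF component_le_norm_cart C'] x)
      finally show "\<bar>vdiv P x\<bar> \<le> (\<Sum>i\<in>UNIV. C' i) * norm x ^ D" by (simp add: sum_distrib_right)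
    qed
  qed
  then have "in_nform D 2 P (\<lambda>_. 0)"
    using P P2 mspan_zero by (simp add: in_nform_def pure12_def)
  with r bd show ?thesis by blast
qed

text \<open>With x = \<phi>(\<eta>), the error splits as D\<psi>(x)(v - P)(x) + (w - F)(\<eta>). The
  first part is controlled by a bounded derivative and by the norm of x being at most a multiple of
  that of \<eta>.\<close>

lemma norm_transport_bound:
  fixes v :: "real^3 \<Rightarrow> real^3"
  assumes \<psi>: "shearcomp \<psi> \<phi>"
    and w: "\<And>x. w (\<psi> x) = frechet_derivative \<psi> (at x) (P x)"
    and wF: "pordv m (\<lambda>x. w x - F x)"
    and r: "0 < r" and bd: "\<And>x. norm x < r \<Longrightarrow> norm (v x - P x) \<le> C * norm x ^ m"
  shows "\<exists>C r. r > 0 \<and> (\<forall>\<eta>. norm \<eta> < r \<longrightarrow>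
    norm (frechet_derivative \<psi> (at (\<phi> \<eta>)) (v (\<phi> \<eta>)) - F \<eta>) \<le> C * norm \<eta> ^ m)"
proof -
  obtain C1 where C1: "0 \<le> C1"
    "\<And>x h. norm x \<le> 1 \<Longrightarrow> norm (frechet_derivative \<psi> (at x) h) \<le> C1 * norm h"
    using pordv_frechet_bound[OF shearcomp_pordv(3)[OF \<psi>]] by blast
  obtain C2 where C2: "0 \<le> C2" "\<And>x. norm x \<le> 1 \<Longrightarrow> norm (\<phi> x) \<le> C2 * norm x"
    using pordv_bound[OF shearcomp_pordv(2)[OF \<psi>]] by auto
  obtain C3 where C3: "0 \<le> C3" "\<And>x. norm x \<le> 1 \<Longrightarrow> norm (w x - F x) \<le> C3 * norm x ^ m"
    using pordv_bound[OF wF] by blast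
  \<comment> \<open>This radius keeps \<phi>(\<eta>) within distance min 1 r of 0; the summand 1
    keeps the denominator positive.\<close>
  define s where "s = min 1 (min 1 r / (C2 + 1))"
  have "norm (frechet_derivative \<psi> (at (\<phi> \<eta>)) (v (\<phi> \<eta>)) - F \<eta>) \<le> (C1 * (\<bar>C\<bar> * C2 ^ m) + C3) * norm \<eta> ^ m"
    if \<eta>: "norm \<eta> < s" for \<eta>
  proof -
    define x where "x = \<phi> \<eta>"
    have x_le: "norm x \<le> C2 * norm \<eta>" using C2(2)[of \<eta>] \<eta> by (simp add: x_def s_def)
    also have "\<dots> \<le> (C2 + 1) * norm \<eta>" by (simp add: mult_right_mono)
    also have "\<dots> < min 1 r"
      using \<eta> C2(1) by (simp add: s_def pos_less_divide_eq mult.commute)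
    finally have x: "norm x < 1" "norm x < r" by auto
    have lin: "linear (frechet_derivative \<psi> (at x))"
      using pordv_frechet_works[OF shearcomp_pordv(3)[OF \<psi>]] has_derivative_linear by blast
    have "norm (v x - P x) \<le> C * norm x ^ m" by (rule bd[OF x(2)])
    also have "\<dots> \<le> \<bar>C\<bar> * (C2 * norm \<eta>) ^ m"
      using x_le by (intro mult_mono power_mono) auto
    finally have vP: "norm (v x - P x) \<le> \<bar>C\<bar> * (C2 * norm \<eta>) ^ m" .
    have "frechet_derivative \<psi> (at x) (v x) - F \<eta> = frechet_derivative \<psi> (at x) (v x - P x) + (w \<eta> - F \<eta>)"
      using w[of x] shearcomp_inverse(2)[OF \<psi>, of \<eta>] linear_diff[OF lin, of "v x" "P x"]
      by (simp add: x_def)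
    also have "norm \<dots> \<le> C1 * (\<bar>C\<bar> * (C2 * norm \<eta>) ^ m) + C3 * norm \<eta> ^ m"
    proof (rule order_trans[OF norm_triangle_ineq add_mono])
      show "norm (frechet_derivative \<psi> (at x) (v x - P x)) \<le> C1 * (\<bar>C\<bar> * (C2 * norm \<eta>) ^ m)"
        using C1(2)[of x "v x - P x"] x(1) mult_left_mono[OF vP C1(1)] by linarith
      show "norm (w \<eta> - F \<eta>) \<le> C3 * norm \<eta> ^ m" using C3(2) \<eta> by (simp add: s_def)
    qed
    finally show ?thesis by (simp add: x_def power_mult_distrib algebra_simps)
  qed
  moreover have "0 < s" using r C2(1) by (simp add: s_def)
  ultimately show ?thesis by blast
qed

theorem theorem1:
  fixes v :: "real^3 \<Rightarrow> real^3" and U :: "(real^3) set"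
  assumes "open U" and "0 \<in> U"
    and "smooth_on U v"
    and "\<forall>x\<in>U. divergence v x = 0"
    and "\<exists>C r. r > 0 \<and> (\<forall>\<xi>. norm \<xi> < r \<longrightarrow> norm (v \<xi> - Nmat *v \<xi>) \<le> C * norm \<xi> ^ 2)"
  shows "\<forall>D::nat. D \<ge> 2 \<longrightarrow>
    (\<exists>\<psi> \<phi> U' V K c.
        open U' \<and> 0 \<in> U' \<and> U' \<subseteq> U \<and> open V \<and> \<psi> ` U' = V \<and>
        (\<forall>x\<in>U'. \<phi> (\<psi> x) = x) \<and> (\<forall>y\<in>V. \<psi> (\<phi> y) = y) \<and>
        smooth_on U' \<psi> \<and> smooth_on V \<phi> \<and>
        (\<forall>x\<in>U'. det (jacobian \<psi> x) = 1) \<and>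
        (\<exists>C r. r > 0 \<and> (\<forall>\<xi>. norm \<xi> < r \<longrightarrow> norm (\<psi> \<xi> - \<xi>) \<le> C * norm \<xi> ^ 2)) \<and>
        (\<forall>i j. i + j < 2 \<longrightarrow> c i j = 0) \<and>
        (\<exists>C r. r > 0 \<and> (\<forall>\<eta>\<in>V. norm \<eta> < r \<longrightarrow>
            norm (frechet_derivative \<psi> (at (\<phi> \<eta>)) (v (\<phi> \<eta>))
                  - (Nmat *v \<eta> + poly2 K c (\<eta>$1) (\<eta>$2) *\<^sub>R e3))
            \<le> C * norm \<eta> ^ (D + 1))))"
proof (intro allI impI)
  fix D :: nat assume D: "2 \<le> D"
  obtain P C r where P: "in_nform D 2 P (\<lambda>_. 0)" and r: "0 < r"
    and bd: "\<And>x. norm x < r \<Longrightarrow> norm (v x - P x) \<le> C * norm x ^ (2 * D)"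
    using taylor_in_nform[OF assms D] by blast
  have "2 + (D - 1) = D + 1" using D by simp
  then obtain \<psi> \<phi> w p where \<psi>: "shearcomp \<psi> \<phi>" and w: "in_nform D (D + 1) w p"
    "\<And>x. w (\<psi> x) = frechet_derivative \<psi> (at x) (P x)"
    using in_nform_reduction[OF P, of "D - 1"] by auto
  then obtain K c where c: "\<And>i j. i + j < 2 \<Longrightarrow> c i j = 0" "\<And>x. p x = poly2 K c (x$1) (x$2)"
    using pure12_poly2[of p] unfolding in_nform_def by metis
  \<comment> \<open>Inside the unit ball the higher power 2 D may be lowered to D + 1.\<close>
  have bd': "norm (v x - P x) \<le> \<bar>C\<bar> * norm x ^ (D + 1)" if "norm x < min r 1" for x
  proof -
    have "C * norm x ^ (2 * D) \<le> \<bar>C\<bar> * norm x ^ (D + 1)"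
      using that D by (intro mult_mono power_decreasing) auto
    then show ?thesis using bd[of x] that by simp
  qed
  have "pordv (D + 1) (\<lambda>x. w x - nform p x)" "0 < min r 1"
    using w(1) r by (simp_all add: in_nform_def)
  note err = norm_transport_bound[OF \<psi> w(2) this bd']
  have "pordv 2 (\<lambda>x. \<psi> x - x)" using shearcomp_near_id[OF \<psi>] by simp
  from pordv_bound[OF this] obtain C' where
    "\<And>x. norm x \<le> 1 \<Longrightarrow> norm (\<psi> x - x) \<le> C' * norm x ^ 2" by metis
  then have near: "\<exists>C r. r > 0 \<and> (\<forall>\<xi>. norm \<xi> < r \<longrightarrow> norm (\<psi> \<xi> - \<xi>) \<le> C * norm \<xi> ^ 2)"
    by (intro exI[of _ C'] exI[of _ 1]) auto
  have "isCont \<phi> y" for y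
    using pordv_has_derivative[OF shearcomp_pordv(4)[OF \<psi>]] has_derivative_continuous by blast
  then have "open (\<phi> -` U)"
    using assms(1) by (intro open_vimage continuous_at_imp_continuous_on) auto
  \<comment> \<open>Because \<psi> and \<phi> are globally inverse, the image is a preimage under
    the continuous \<phi>, hence open.\<close>
  moreover have "\<psi> ` U = \<phi> -` U"
  proof (intro equalityI subsetI)
    fix y assume "y \<in> \<phi> -` U"
    then show "y \<in> \<psi> ` U"
      using shearcomp_inverse(2)[OF \<psi>, of y] by (metis imageI vimageD)
  qed (auto simp: shearcomp_inverse(1)[OF \<psi>])
  ultimately have V: "open (\<psi> ` U)" by simp
  show "\<exists>\<psi> \<phi> U' V K c.
        open U' \<and> 0 \<in> U' \<and> U' \<subseteq> U \<and> open V \<and> \<psi> ` U' = V \<and>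
        (\<forall>x\<in>U'. \<phi> (\<psi> x) = x) \<and> (\<forall>y\<in>V. \<psi> (\<phi> y) = y) \<and>
        smooth_on U' \<psi> \<and> smooth_on V \<phi> \<and>
        (\<forall>x\<in>U'. det (jacobian \<psi> x) = 1) \<and>
        (\<exists>C r. r > 0 \<and> (\<forall>\<xi>. norm \<xi> < r \<longrightarrow> norm (\<psi> \<xi> - \<xi>) \<le> C * norm \<xi> ^ 2)) \<and>
        (\<forall>i j. i + j < 2 \<longrightarrow> c i j = 0) \<and>
        (\<exists>C r. r > 0 \<and> (\<forall>\<eta>\<in>V. norm \<eta> < r \<longrightarrow>
            norm (frechet_derivative \<psi> (at (\<phi> \<eta>)) (v (\<phi> \<eta>))
                  - (Nmat *v \<eta> + poly2 K c (\<eta>$1) (\<eta>$2) *\<^sub>R e3))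
            \<le> C * norm \<eta> ^ (D + 1)))"
  \<comment> \<open>The polynomial automorphism is defined on the whole space, so U itself serves as
    the domain without shrinking.\<close>
  proof (rule exI[of _ \<psi>], rule exI[of _ \<phi>], rule exI[of _ U], rule exI[of _ "\<psi> ` U"],
      rule exI[of _ K], rule exI[of _ c], intro conjI)
    show "\<exists>C r. r > 0 \<and> (\<forall>\<eta>\<in>\<psi> ` U. norm \<eta> < r \<longrightarrow>
        norm (frechet_derivative \<psi> (at (\<phi> \<eta>)) (v (\<phi> \<eta>))
              - (Nmat *v \<eta> + poly2 K c (\<eta>$1) (\<eta>$2) *\<^sub>R e3))
        \<le> C * norm \<eta> ^ (D + 1))"
      using err unfolding nform_def c(2) by blast
  qed (use assms(1,2) V near c(1) shearcomp_inverse[OF \<psi>] shearcomp_det[OF \<psi>]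
      pordv_smooth_on[OF shearcomp_pordv(3)[OF \<psi>]]
      pordv_smooth_on[OF shearcomp_pordv(4)[OF \<psi>]] in auto)
qed

end
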